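(* Let $D$ be a weakly locally finite division ring with center $F$ and let $K$ be a proper division subring of $D$. Then every normal subgroup $N$ of $D^*$ which is radical over $K$ (i.e. for each $x\in N$ there is a positive integer $n$ with $x^n\in K$) is contained in $F$.
   Context: A division ring $D$ is weakly locally finite if for every finite subset $S\subseteq D$, the division subring generated by $S$ is finite dimensional over its own center. *)

theory Defs
  imports Main
begin

text \<open>The division ring D is the ambient type 'a of class division_ring.
  Division subrings are subsets of this type.\<close>

definition division_subring :: "'a::division_ring set \<Rightarrow> bool" where
  "division_subring K \<longleftrightarrow>
     0 \<in> K \<and> 1 \<in> K \<and>
     (\<forall>x\<in>K. \<forall>y\<in>K. x + y \<in> K \<and> x * y \<in> K) \<and>
     (\<forall>x\<in>K. - x \<in> K) \<and>
     (\<forall>x\<in>K. x \<noteq> 0 \<longrightarrow> inverse x \<in> K)"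

definition gen_division_subring :: "'a::division_ring set \<Rightarrow> 'a set" where
  "gen_division_subring S = \<Inter> {K. division_subring K \<and> S \<subseteq> K}"

definition center_of :: "'a::division_ring set \<Rightarrow> 'a set" where
  "center_of E = {z \<in> E. \<forall>y\<in>E. z * y = y * z}"

definition fin_dim_over_center :: "'a::division_ring set \<Rightarrow> bool" where
  "fin_dim_over_center E \<longleftrightarrow>
     (\<exists>B. finite B \<and> B \<subseteq> E \<and>
        (\<forall>x\<in>E. \<exists>c. (\<forall>b\<in>B. c b \<in> center_of E) \<and> x = (\<Sum>b\<in>B. c b * b)))"

definition weakly_locally_finite :: "'a::division_ring itself \<Rightarrow> bool" where
  "weakly_locally_finite _ \<longleftrightarrow>
     (\<forall>S::'a set. finite S \<longrightarrow> fin_dim_over_center (gen_division_subring S))"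

definition normal_subgroup_units :: "'a::division_ring set \<Rightarrow> bool" where
  "normal_subgroup_units N \<longleftrightarrow>
     N \<subseteq> - {0} \<and> 1 \<in> N \<and>
     (\<forall>x\<in>N. \<forall>y\<in>N. x * y \<in> N) \<and>
     (\<forall>x\<in>N. inverse x \<in> N) \<and>
     (\<forall>d. d \<noteq> 0 \<longrightarrow> (\<forall>x\<in>N. d * x * inverse d \<in> N))"

definition radical_over :: "'a::division_ring set \<Rightarrow> 'a set \<Rightarrow> bool" where
  "radical_over N K \<longleftrightarrow> (\<forall>x\<in>N. \<exists>n::nat. n > 0 \<and> x ^ n \<in> K)"

end

theory Submission
  imports Defs "HOL-Computational_Algebra.Primes" "HOL-Library.FuncSet"
begin

text \<open>
  For \<open>y \<in> N\<close> and \<open>a \<notin> K\<close>, some power \<open>z\<close> of \<open>y\<close> and its conjugates by \<open>a\<close> and \<open>a + 1\<close> lie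
  in \<open>K\<close>; comparing them forces \<open>a z = z a\<close>. Hence every element of \<open>D\<close> commutes with a power of \<open>y\<close>,
  and on passing to the division subring \<open>E\<close> generated by two elements we may assume that \<open>E\<close>
  is finite dimensional over its center \<open>F\<close> and that \<open>N\<close> is radical over \<open>F\<close>.

  If \<open>F\<close> has characteristic 0 or contains a nontorsion element, there is a valuation ring \<open>V\<close> of \<open>F\<close>
  in which 2, respectively that element, is a nonunit, and an order \<open>R\<close> of \<open>E\<close> over \<open>V\<close>. As in
  Minkowski's lemma, an element close to 1 in \<open>R\<close> with a power in \<open>F\<close> lies in \<open>F\<close>. Apply this to the
  commutators of \<open>1 + t a\<close> and \<open>x \<in> N\<close> for small \<open>t\<close>. In characteristic \<open>p\<close> the exponents divisible
  by \<open>p\<close> need a separate argument, through an element \<open>e\<close> with \<open>y e y\<inverse> = e + 1\<close>.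

  If \<open>F\<close> is algebraic over a finite field, every element of \<open>E\<close> is torsion. A noncentral \<open>x\<close>
  is then normalized but not centralized by some \<open>b\<close>, and surjectivity of the norm of finite
  fields yields \<open>c\<close> with \<open>(c b)\<^sup>r = 1\<close>, which contradicts the independence of the powers of \<open>c b\<close>.
\<close>

section \<open>Subrings and torsion elements\<close>

definition is_subring :: "'a::ring_1 set \<Rightarrow> bool" where
  "is_subring A \<longleftrightarrow> 1 \<in> A \<and> (\<forall>x\<in>A. \<forall>y\<in>A. x - y \<in> A \<and> x * y \<in> A)"

lemma is_subringD:
  assumes "is_subring A"
  shows "1 \<in> A" "0 \<in> A" "x \<in> A \<Longrightarrow> y \<in> A \<Longrightarrow> x - y \<in> A" "x \<in> A \<Longrightarrow> y \<in> A \<Longrightarrow> x * y \<in> A"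
    "x \<in> A \<Longrightarrow> - x \<in> A" "x \<in> A \<Longrightarrow> y \<in> A \<Longrightarrow> x + y \<in> A" "x \<in> A \<Longrightarrow> x ^ n \<in> A"
proof -
  show 1: "1 \<in> A" and d: "x \<in> A \<Longrightarrow> y \<in> A \<Longrightarrow> x - y \<in> A"
    and m: "x \<in> A \<Longrightarrow> y \<in> A \<Longrightarrow> x * y \<in> A" for x y
    using assms unfolding is_subring_def by auto
  show 0: "0 \<in> A" using d[OF 1 1] by simp
  show u: "x \<in> A \<Longrightarrow> - x \<in> A" for x using d[OF 0, of x] by simp
  show "x \<in> A \<Longrightarrow> y \<in> A \<Longrightarrow> x + y \<in> A" using d[of x "- y"] u[of y] by simp
  show "x \<in> A \<Longrightarrow> x ^ n \<in> A" by (induction n) (auto simp: 1 m)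
qed

lemma subring_sum: "is_subring A \<Longrightarrow> (\<And>i. i \<in> I \<Longrightarrow> f i \<in> A) \<Longrightarrow> sum f I \<in> A"
  by (induction I rule: infinite_finite_induct) (auto simp: is_subringD)

lemma subring_of_nat: "is_subring A \<Longrightarrow> of_nat n \<in> A"
  by (induction n) (auto simp: is_subringD)

lemma subring_of_int: "is_subring A \<Longrightarrow> of_int n \<in> A"
  by (cases n rule: int_cases2) (auto simp: is_subringD subring_of_nat)

lemma is_subring_Ints: "is_subring (\<int> :: 'a::ring_1 set)"
  by (auto simp: is_subring_def)

lemma division_subring_is_subring: "division_subring K \<Longrightarrow> is_subring K"
  unfolding division_subring_def is_subring_def
  by (metis diff_conv_add_uminus)

lemma division_subring_inverse: "division_subring K \<Longrightarrow> x \<in> K \<Longrightarrow> inverse x \<in> K"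
  unfolding division_subring_def by (cases "x = 0") auto

lemmas division_subringD = is_subringD[OF division_subring_is_subring] division_subring_inverse

lemma inverse_commute:
  fixes x y :: "'a::division_ring"
  assumes "x * y = y * x" shows "inverse x * y = y * inverse x"
proof (cases "x = 0")
  case False
  have "inverse x * (y * x) * inverse x = inverse x * (x * y) * inverse x" by (simp add: assms)
  then show ?thesis using False
    by (metis left_inverse mult.assoc mult.left_neutral mult.right_neutral right_inverse)
qed simp

lemma division_subring_centralizer: "division_subring {y::'a::division_ring. \<forall>x\<in>S. x * y = y * x}"
  unfolding division_subring_def
proof (intro conjI ballI impI)
  fix x y assume *: "x \<in> {y. \<forall>x\<in>S. x * y = y * x}" "y \<in> {y. \<forall>x\<in>S. x * y = y * x}"
  show "x + y \<in> {y. \<forall>x\<in>S. x * y = y * x}" using * by (simp add: algebra_simps)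
  show "x * y \<in> {y. \<forall>x\<in>S. x * y = y * x}" using * by simp (metis mult.assoc)
next
  fix x assume *: "x \<in> {y. \<forall>x\<in>S. x * y = y * x}"
  show "inverse x \<in> {y. \<forall>x\<in>S. x * y = y * x}"
    using * by (auto simp: inverse_commute)
qed auto

lemma division_subring_Int: "division_subring K \<Longrightarrow> division_subring L \<Longrightarrow> division_subring (K \<inter> L)"
  unfolding division_subring_def by auto

lemma center_of_eq: "center_of E = E \<inter> {y. \<forall>x\<in>E. x * y = y * x}"
  unfolding center_of_def by auto

lemma division_subring_center: "division_subring E \<Longrightarrow> division_subring (center_of E)"
  unfolding center_of_eq by (intro division_subring_Int division_subring_centralizer)

lemma center_ofD: "z \<in> center_of E \<Longrightarrow> z \<in> E" "z \<in> center_of E \<Longrightarrow> y \<in> E \<Longrightarrow> z * y = y * z"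
  unfolding center_of_def by auto

section \<open>Polynomial expressions in one element and simple extensions of subrings\<close>

text \<open>Values at \<open>x\<close> of polynomials of degree at most \<open>n\<close>, in Horner
  form, so that inductions strip the constant term. Closure under multiplication by \<open>A\<close>
  on the left depends on \<open>x\<close> commuting with \<open>A\<close>.\<close>

primrec polys :: "'a::ring_1 set \<Rightarrow> 'a \<Rightarrow> nat \<Rightarrow> 'a set" where
  "polys A x 0 = A"
| "polys A x (Suc n) = {a + x * r | a r. a \<in> A \<and> r \<in> polys A x n}"

definition adjoin :: "'a::ring_1 set \<Rightarrow> 'a \<Rightarrow> 'a set" where
  "adjoin A x = (\<Union>n. polys A x n)"

declare polys.simps(2) [simp del]

lemma zero_in_polys: "is_subring A \<Longrightarrow> 0 \<in> polys A x n"
  by (induction n) (force simp: is_subringD polys.simps(2))+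

lemma polys_SucI: "a \<in> A \<Longrightarrow> r \<in> polys A x n \<Longrightarrow> a + x * r \<in> polys A x (Suc n)"
  by (auto simp: polys.simps(2))

lemma polys_SucE:
  assumes "r \<in> polys A x (Suc n)"
  obtains a s where "a \<in> A" "s \<in> polys A x n" "r = a + x * s"
  using assms by (auto simp: polys.simps(2))

lemma polys_mult_x: "is_subring A \<Longrightarrow> r \<in> polys A x n \<Longrightarrow> x * r \<in> polys A x (Suc n)"
  using polys_SucI[of 0 A r x n] by (simp add: is_subringD)

lemma polys_base: "is_subring A \<Longrightarrow> A \<subseteq> polys A x n"
proof (cases n)
  case (Suc m)
  assume "is_subring A"
  then show ?thesis using polys_SucI[OF _ zero_in_polys, of _ A x m] Suc by auto
qed simp

lemma polys_Suc_mono: "is_subring A \<Longrightarrow> polys A x n \<subseteq> polys A x (Suc n)"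
proof (induction n)
  case 0
  then show ?case using polys_base[of A x 1] by simp
next
  case (Suc n)
  then show ?case by (subst (1) polys.simps(2), subst polys.simps(2)) blast
qed

lemma polys_mono: "is_subring A \<Longrightarrow> m \<le> n \<Longrightarrow> polys A x m \<subseteq> polys A x n"
  using lift_Suc_mono_le[of "polys A x", OF polys_Suc_mono] by blast

lemma polys_diff:
  "is_subring A \<Longrightarrow> r \<in> polys A x n \<Longrightarrow> s \<in> polys A x n \<Longrightarrow> r - s \<in> polys A x n"
proof (induction n arbitrary: r s)
  case (Suc n)
  then obtain a b r' s' where *: "a \<in> A" "b \<in> A" "r' \<in> polys A x n" "s' \<in> polys A x n"
    "r = a + x * r'" "s = b + x * s'" by (auto elim!: polys_SucE)
  then have eq: "r - s = (a - b) + x * (r' - s')" by (simp add: algebra_simps)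
  show ?case unfolding eq using *  Suc polys_SucI[of "a - b" A "r' - s'" x n] is_subringD(3)[of A a b] by simp
qed (simp add: is_subringD)

lemma polys_add:
  assumes "is_subring A" "r \<in> polys A x n" "s \<in> polys A x n" shows "r + s \<in> polys A x n"
  using polys_diff[OF assms(1,2) polys_diff[OF assms(1) zero_in_polys[OF assms(1)] assms(3)]] by simp

lemma polys_scale:
  assumes "is_subring A" "\<And>a. a \<in> A \<Longrightarrow> x * a = a * x"
  shows "a \<in> A \<Longrightarrow> r \<in> polys A x n \<Longrightarrow> a * r \<in> polys A x n"
proof (induction n arbitrary: r)
  case (Suc n)
  then obtain b r' where *: "b \<in> A" "r' \<in> polys A x n" "r = b + x * r'" by (auto elim: polys_SucE)
  have "a * r = a * b + x * (a * r')"
    using * assms(2)[OF Suc.prems(1)] by (simp add: distrib_left flip: mult.assoc)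
  then show ?case using * Suc assms(1) polys_SucI[of "a * b" A "a * r'" x n] is_subringD(4)[of A a b] by simp
qed (simp add: is_subringD assms(1))

lemma polys_monomial:
  assumes "is_subring A" "\<And>a. a \<in> A \<Longrightarrow> x * a = a * x"
  shows "a \<in> A \<Longrightarrow> a * x ^ n \<in> polys A x n"
proof (induction n)
  case (Suc n)
  have "a * x ^ Suc n = x * (a * x ^ n)" using assms(2)[OF Suc.prems] by (simp flip: mult.assoc)
  then show ?case using polys_mult_x[OF assms(1) Suc.IH[OF Suc.prems]] by simp
qed simp

text \<open>The recursion exposes the constant term, but lowering a degree needs the leading term;
  commutation with \<open>x\<close> lets the induction move it outward.\<close>

lemma polys_top_coeff:
  assumes A: "is_subring A" and comm: "\<And>a. a \<in> A \<Longrightarrow> x * a = a * x"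
  shows "r \<in> polys A x (Suc n) \<Longrightarrow> \<exists>s\<in>polys A x n. \<exists>c\<in>A. r = s + c * x ^ Suc n"
proof (induction n arbitrary: r)
  case 0
  then obtain a c where "a \<in> A" "c \<in> A" "r = a + x * c" by (auto elim: polys_SucE)
  then show ?case using comm[of c] by auto
next
  case (Suc n)
  then obtain a r' where *: "a \<in> A" "r' \<in> polys A x (Suc n)" "r = a + x * r'" by (auto elim: polys_SucE)
  obtain s c where s: "s \<in> polys A x n" "c \<in> A" "r' = s + c * x ^ Suc n" using Suc.IH[OF *(2)] by blast
  have "r = (a + x * s) + c * x ^ Suc (Suc n)"
    using * s comm[OF s(2)] by (simp add: algebra_simps flip: mult.assoc)
  then show ?case using polys_SucI[OF *(1) s(1)] s(2) by blast
qed

text \<open>Reversal of coefficients: a relation for \<open>x\<close> becomes, after division by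
  \<open>x ^ n\<close>, a relation for \<open>inverse x\<close>.\<close>

lemma polys_reverse:
  fixes x :: "'a::division_ring"
  assumes A: "is_subring A" and comm: "\<And>a. a \<in> A \<Longrightarrow> x * a = a * x" and "x \<noteq> 0"
  shows "r \<in> polys A x n \<Longrightarrow> inverse x ^ n * r \<in> polys A (inverse x) n"
proof (induction n arbitrary: r)
  case (Suc n)
  then obtain a r' where *: "a \<in> A" "r' \<in> polys A x n" "r = a + x * r'" by (auto elim: polys_SucE)
  have comm': "inverse x * a = a * inverse x" if "a \<in> A" for a
    by (rule inverse_commute) (rule comm[OF that])
  have 1: "inverse x ^ Suc n * a = a * inverse x ^ Suc n"
    by (rule power_commuting_commutes) (rule comm'[OF *(1)])
  have 2: "inverse x ^ Suc n * (x * r') = inverse x ^ n * r'"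
    using \<open>x \<noteq> 0\<close> by (subst power_Suc2) (simp add: mult.assoc flip: mult.assoc[of "inverse x" x])
  have "inverse x ^ Suc n * r = a * inverse x ^ Suc n + inverse x ^ n * r'"
    using * 1 2 by (simp only: distrib_left)
  then show ?case
    using polys_add[OF A polys_monomial[OF A comm' *(1), of "Suc n"], of "inverse x ^ n * r'"]
      Suc.IH[OF *(2)] polys_Suc_mono[OF A, of "inverse x" n] by (metis subsetD)
qed simp

lemma adjoin_mult:
  assumes A: "is_subring A" and comm: "\<And>a. a \<in> A \<Longrightarrow> x * a = a * x"
  shows "r \<in> polys A x n \<Longrightarrow> s \<in> adjoin A x \<Longrightarrow> r * s \<in> adjoin A x"
proof (induction n arbitrary: r)
  case 0
  then show ?case using polys_scale[OF A comm] unfolding adjoin_def by auto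
next
  case (Suc n)
  then obtain a r' where *: "a \<in> A" "r' \<in> polys A x n" "r = a + x * r'" by (auto elim: polys_SucE)
  obtain k where k: "s \<in> polys A x k" using Suc.prems unfolding adjoin_def by auto
  obtain m where m: "r' * s \<in> polys A x m" using Suc.IH[OF *(2) Suc.prems(2)] unfolding adjoin_def by auto
  have 1: "a * s \<in> polys A x k" using polys_scale[OF A comm *(1) k] by simp
  have 2: "x * (r' * s) \<in> polys A x (Suc m)" by (rule polys_mult_x[OF A m])
  have "r * s = a * s + x * (r' * s)" using * by (simp add: algebra_simps)
  also have "\<dots> \<in> polys A x (max k (Suc m))"
    using polys_add[OF A] 1 2 polys_mono[OF A] by (meson max.cobounded1 max.cobounded2 subsetD)
  finally show ?case unfolding adjoin_def by blast
qed

lemma is_subring_adjoin: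
  assumes A: "is_subring A" and comm: "\<And>a. a \<in> A \<Longrightarrow> x * a = a * x"
  shows "is_subring (adjoin A x)"
  unfolding is_subring_def
proof (intro conjI ballI)
  show "1 \<in> adjoin A x" using is_subringD(1)[OF A] unfolding adjoin_def by (auto intro: exI[of _ 0])
next
  fix r s assume "r \<in> adjoin A x" "s \<in> adjoin A x"
  then obtain n m where n: "r \<in> polys A x n" and m: "s \<in> polys A x m" unfolding adjoin_def by auto
  then have "r - s \<in> polys A x (max n m)"
    using polys_diff[OF A] polys_mono[OF A] by (meson max.cobounded1 max.cobounded2 subsetD)
  then show "r - s \<in> adjoin A x" unfolding adjoin_def by blast
  show "r * s \<in> adjoin A x" using adjoin_mult[OF A comm n \<open>s \<in> adjoin A x\<close>] .
qed

lemma adjoin_base: "is_subring A \<Longrightarrow> A \<subseteq> adjoin A x"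
  unfolding adjoin_def using polys.simps(1)[of A x] by blast

lemma adjoin_self: "is_subring A \<Longrightarrow> x \<in> adjoin A x"
  using polys_SucI[of 0 A 1 x 0] is_subringD(1,2)[of A] by (force simp: adjoin_def)

lemma adjoin_least:
  assumes "is_subring B" "A \<subseteq> B" "x \<in> B"
  shows "adjoin A x \<subseteq> B"
proof -
  have "polys A x n \<subseteq> B" for n
    by (induction n)
      (use assms(2,3) in \<open>auto elim!: polys_SucE intro!: is_subringD(4,6)[OF assms(1)]\<close>)
  then show ?thesis unfolding adjoin_def by auto
qed

lemma finite_polys: "finite A \<Longrightarrow> finite (polys A x n)"
proof (induction n)
  case (Suc n)
  have "polys A x (Suc n) = (\<lambda>(a, r). a + x * r) ` (A \<times> polys A x n)"
    by (force simp: polys.simps(2))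
  then show ?case using Suc by (metis finite_SigmaI finite_imageI)
qed simp

text \<open>Multiplication by \<open>x\<close> preserves \<open>polys A x n\<close>: the only
  overflow is a leading term, and \<open>int\<close> replaces it by lower powers.\<close>

lemma adjoin_integral:
  assumes A: "is_subring A" and comm: "\<And>a. a \<in> A \<Longrightarrow> x * a = a * x"
    and int: "x ^ Suc n \<in> polys A x n"
  shows "adjoin A x = polys A x n"
proof -
  have step: "x * r \<in> polys A x n" if r: "r \<in> polys A x n" for r
  proof -
    obtain s c where "s \<in> polys A x n" "c \<in> A" "x * r = s + c * x ^ Suc n"
      using polys_top_coeff[OF A comm, of "x * r" n] polys_mult_x[OF A r] by auto
    then show ?thesis using polys_add[OF A] polys_scale[OF A comm _ int] by simp
  qed
  have "polys A x k \<subseteq> polys A x n" for k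
  proof (induction k)
    case 0
    then show ?case using polys_base[OF A] by simp
  next
    case (Suc k)
    show ?case
    proof
      fix r assume "r \<in> polys A x (Suc k)"
      then obtain a r' where *: "a \<in> A" "r' \<in> polys A x k" "r = a + x * r'" by (auto elim: polys_SucE)
      then have "x * r' \<in> polys A x n" "a \<in> polys A x n" using step Suc polys_base[OF A, of x n] by auto
      then show "r \<in> polys A x n" using polys_add[OF A] *(3) by simp
    qed
  qed
  then show ?thesis unfolding adjoin_def by auto
qed

section \<open>Torsion elements and finite commutative subrings\<close>

definition torsion :: "'a::monoid_mult \<Rightarrow> bool" where
  "torsion x \<longleftrightarrow> (\<exists>n>0. x ^ n = 1)"

lemma torsion_powerD: "torsion (x ^ n) \<Longrightarrow> n > 0 \<Longrightarrow> torsion x"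
  unfolding torsion_def by (metis nat_0_less_mult_iff power_mult)

lemma torsion_power: "torsion x \<Longrightarrow> torsion (x ^ n)"
  unfolding torsion_def by (metis mult.commute power_mult power_one)

lemma torsion_nonzero: "torsion (x::'a::division_ring) \<Longrightarrow> x \<noteq> 0"
  unfolding torsion_def by (metis power_0_left less_numeral_extra(3) zero_neq_one)

lemma torsion_if_finite_powers:
  fixes x :: "'a::division_ring"
  assumes "finite A" "\<And>n. x ^ n \<in> A" "x \<noteq> 0"
  shows "torsion x"
proof -
  have "\<not> inj (\<lambda>n::nat. x ^ n)"
    using assms finite_subset[of "range (\<lambda>n. x ^ n)" A] finite_imageD[of "\<lambda>n. x ^ n" UNIV] by auto
  then obtain i j :: nat where "i \<noteq> j" "x ^ i = x ^ j" unfolding inj_def by blast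
  then obtain i j :: nat where ij: "i < j" "x ^ i = x ^ j" by (metis linorder_neqE_nat)
  have "x ^ i * x ^ (j - i) = x ^ j" using ij(1) by (metis le_add_diff_inverse less_imp_le power_add)
  then have "x ^ i * x ^ (j - i) = x ^ i * 1" using ij(2) by simp
  then have "x ^ (j - i) = 1" using assms(3) by (metis mult_left_cancel power_not_zero)
  then show ?thesis unfolding torsion_def using ij(1) by (metis zero_less_diff)
qed

lemma finite_subring_torsion:
  fixes x :: "'a::division_ring"
  assumes "finite A" "is_subring A" "x \<in> A" "x \<noteq> 0"
  shows "torsion x"
  using torsion_if_finite_powers[OF assms(1) _ assms(4)] is_subringD(7)[OF assms(2,3)] by blast

lemma finite_subring_inverse:
  fixes x :: "'a::division_ring"
  assumes "finite A" "is_subring A" "x \<in> A"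
  shows "inverse x \<in> A"
proof (cases "x = 0")
  case False
  then obtain n where n: "n > 0" "x ^ n = 1" using finite_subring_torsion[OF assms] unfolding torsion_def by auto
  have "x * x ^ (n - 1) = 1" using n by (metis power_minus_mult power_commutes)
  then have "inverse x = x ^ (n - 1)" using inverse_unique by blast
  then show ?thesis using is_subringD(7)[OF assms(2,3)] by simp
qed (use assms is_subringD in auto)

text \<open>A torsion element satisfies a monic equation \<open>x ^ Suc k = 1\<close>, so
  polynomials of bounded degree suffice.\<close>

lemma adjoin_torsion_finite:
  fixes x :: "'a::division_ring"
  assumes "finite A" "is_subring A" "\<And>a. a \<in> A \<Longrightarrow> x * a = a * x" "torsion x"
  shows "finite (adjoin A x)"
proof -
  obtain n where n: "n > 0" "x ^ n = 1" using assms(4) unfolding torsion_def by auto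
  then obtain k where "x ^ Suc k = 1" by (metis gr0_implies_Suc)
  then have "x ^ Suc k \<in> polys A x k" using polys_base[OF assms(2)] is_subringD(1)[OF assms(2)] by auto
  then show ?thesis using adjoin_integral[OF assms(2,3)] finite_polys[OF assms(1)] by metis
qed

lemma finite_Ints:
  assumes "CHAR('a::ring_1) > 0"
  shows "finite (\<int> :: 'a set)"
proof -
  have "(\<int> :: 'a set) \<subseteq> of_int ` {0..<int CHAR('a)}"
  proof
    fix x :: 'a assume "x \<in> \<int>"
    then obtain k where k: "x = of_int k" by (rule Ints_cases)
    have "of_int (int CHAR('a) * (k div int CHAR('a))) = (0::'a)" by simp
    then have "x = of_int (k mod int CHAR('a))"
      unfolding k by (metis add_0 div_mult_mod_eq mult.commute of_int_add)
    then show "x \<in> of_int ` {0..<int CHAR('a)}" using assms by auto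
  qed
  then show ?thesis using finite_subset by blast
qed

lemma Ints_commute: "x \<in> \<int> \<Longrightarrow> y * x = x * (y::'a::ring_1)"
  by (metis Ints_cases mult_of_int_commute)

text \<open>If \<open>inverse x\<close> is a polynomial of degree \<open>n\<close> in
  \<open>x\<close>, division by \<open>x ^ n\<close> yields a monic equation for
  \<open>inverse x\<close> over the finite prime field, so its powers stay in a finite ring.
  Contrapositively, a nontorsion element can be made a nonunit of a valuation ring.\<close>

lemma inverse_in_adjoin_Ints_torsion:
  fixes x :: "'a::division_ring"
  assumes "CHAR('a) > 0" "x \<noteq> 0" "inverse x \<in> adjoin \<int> x"
  shows "torsion x"
proof -
  define y where "y = inverse x"
  have y: "y \<noteq> 0" "inverse y = x" using assms(2) unfolding y_def by auto
  obtain n where n: "y \<in> polys \<int> x n" using assms(3) unfolding adjoin_def y_def by auto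
  have "y ^ n * y \<in> polys \<int> y n"
    using polys_reverse[OF is_subring_Ints _ assms(2) n] Ints_commute unfolding y_def by blast
  then have "y ^ Suc n \<in> polys \<int> y n" by (simp add: power_commutes)
  then have "finite (adjoin \<int> y)"
    using adjoin_integral[OF is_subring_Ints Ints_commute] finite_polys[OF finite_Ints[OF assms(1)]] by metis
  then have "torsion y"
    using finite_subring_torsion is_subring_adjoin[OF is_subring_Ints Ints_commute]
      adjoin_self[OF is_subring_Ints] y(1) by blast
  then show ?thesis unfolding torsion_def y_def by (metis inverse_1 power_inverse inverse_inverse_eq)
qed

text \<open>The generators are adjoined one at a time. Minimality of \<open>A\<close> transfers
  properties of the generators, such as commuting with the next one, to all of
  \<open>A\<close>.\<close>

lemma finite_subring_of_torsion:
  fixes S :: "'a::division_ring set"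
  assumes "CHAR('a) > 0" "finite S" "\<And>x. x \<in> S \<Longrightarrow> torsion x \<or> x = 0"
    "\<And>x y. x \<in> S \<Longrightarrow> y \<in> S \<Longrightarrow> x * y = y * x"
  shows "\<exists>A. finite A \<and> is_subring A \<and> S \<subseteq> A \<and>
     (\<forall>B. is_subring B \<longrightarrow> S \<subseteq> B \<longrightarrow> A \<subseteq> B)"
  using assms(2-4)
proof (induction S rule: finite_induct)
  case empty
  then show ?case
    using finite_Ints[OF assms(1)] is_subring_Ints
    by (intro exI[of _ \<int>]) (auto elim!: Ints_cases intro: subring_of_int)
next
  case (insert x S)
  then obtain A where A: "finite A" "is_subring A" "S \<subseteq> A"
    and least: "\<forall>B. is_subring B \<longrightarrow> S \<subseteq> B \<longrightarrow> A \<subseteq> B" by auto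
  have "is_subring {y. \<forall>z\<in>{x}. z * y = y * z}"
    by (intro division_subring_is_subring division_subring_centralizer)
  then have "A \<subseteq> {y. \<forall>z\<in>{x}. z * y = y * z}" using least insert.prems(2) by auto
  then have comm: "\<And>a. a \<in> A \<Longrightarrow> x * a = a * x" by auto
  show ?case
  proof (cases "x = 0")
    case True
    then show ?thesis using A least is_subringD(2) by (intro exI[of _ A]) auto
  next
    case False
    then have "torsion x" using insert.prems by auto
    then show ?thesis
      using A adjoin_torsion_finite[OF A(1,2) comm] is_subring_adjoin[OF A(2) comm]
        adjoin_base[OF A(2), of x] adjoin_self[OF A(2), of x] least adjoin_least[of _ A x]
      by (intro exI[of _ "adjoin A x"]) auto
  qed
qed

lemma prime_CHAR:
  assumes "CHAR('a::division_ring) > 0"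
  shows "prime CHAR('a)"
  unfolding prime_nat_iff
proof (intro conjI allI impI)
  show "1 < CHAR('a)" using assms CHAR_not_1[where ?'a = 'a] by linarith
next
  fix m assume "m dvd CHAR('a)"
  then obtain k where k: "CHAR('a) = m * k" by auto
  then have "of_nat m * of_nat k = (0::'a)" by (metis of_nat_CHAR of_nat_mult)
  then have "CHAR('a) dvd m \<or> CHAR('a) dvd k"
    by (simp flip: of_nat_eq_0_iff_char_dvd)
  then show "m = 1 \<or> m = CHAR('a)" using k assms
    by (metis dvd_antisym dvd_triv_left dvd_triv_right mult.commute mult_cancel1 nat_0_less_mult_iff nat_mult_1_right neq0_conv)
qed

section \<open>Valuation rings of the center and orders over them\<close>

definition valuation_subring :: "'a::division_ring set \<Rightarrow> 'a set \<Rightarrow> bool" where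
  "valuation_subring F V \<longleftrightarrow> is_subring V \<and> V \<subseteq> F \<and> (\<forall>f\<in>F. f \<in> V \<or> inverse f \<in> V)"

text \<open>Chevalley's argument: if neither \<open>f\<close> nor \<open>inverse f\<close> were in
  \<open>V\<close>, maximality would put \<open>inverse t\<close> into both simple extensions, and
  the degrees of the two polynomial expressions could be lowered forever.\<close>

lemma valuation_subring_if_maximal:
  fixes F V :: "'a::division_ring set"
  assumes F: "division_subring F" and commF: "\<And>x y. x \<in> F \<Longrightarrow> y \<in> F \<Longrightarrow> x * y = y * x"
    and V: "is_subring V" "V \<subseteq> F" "t \<in> V" "t \<noteq> 0" "inverse t \<notin> V"
    and max: "\<And>A. is_subring A \<Longrightarrow> A \<subseteq> F \<Longrightarrow> V \<subseteq> A \<Longrightarrow> inverse t \<notin> A \<Longrightarrow> A = V"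
  shows "valuation_subring F V"
proof -
  have tF: "t \<in> F" using V by auto
  have commV: "x * a = a * x" if "x \<in> F" "a \<in> V" for x a using commF that V(2) by auto
  have adj: "inverse t \<in> adjoin V x" if x: "x \<in> F" "x \<notin> V" for x
  proof (rule ccontr)
    assume "inverse t \<notin> adjoin V x"
    moreover have "adjoin V x \<subseteq> F"
      by (rule adjoin_least[OF division_subring_is_subring[OF F] V(2) x(1)])
    ultimately have "adjoin V x = V"
      using max is_subring_adjoin[OF V(1) commV[OF x(1)]] adjoin_base[OF V(1)] by blast
    then show False using adjoin_self[OF V(1), of x] x(2) by auto
  qed
  \<comment> \<open>\<open>t\<close> behaves like an element of the Jacobson radical. If
    \<open>g = 1 - t * a\<close> had no inverse in \<open>V\<close>, then \<open>inverse t\<close>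
    would be a polynomial in \<open>inverse g\<close>; multiplying by \<open>g ^ n\<close>, which
    has the form \<open>1 - t * d\<close>, would put \<open>inverse t\<close> into
    \<open>V\<close>.\<close>
  have unit: "inverse (1 - t * a) \<in> V" if a: "a \<in> V" for a
  proof (rule ccontr)
    define g where "g = 1 - t * a"
    have gV: "g \<in> V" unfolding g_def using V a by (intro is_subringD(3,4)[OF V(1)] is_subringD(1)[OF V(1)])
    assume "inverse (1 - t * a) \<notin> V"
    then have g: "inverse g \<notin> V" unfolding g_def .
    then have g0: "inverse g \<noteq> 0" using is_subringD(2)[OF V(1)] by metis
    have gF: "inverse g \<in> F" using gV V(2) division_subring_inverse[OF F] by auto
    obtain n where n: "inverse t \<in> polys V (inverse g) n"
      using adj[OF gF g] unfolding adjoin_def by auto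
    have "g ^ n * inverse t \<in> polys V g n"
      using polys_reverse[OF V(1) commV[OF gF] g0 n] by simp
    then have c: "g ^ n * inverse t \<in> V" using adjoin_least[OF V(1) order.refl gV] unfolding adjoin_def by auto
    have "\<exists>d\<in>V. g ^ k = 1 - t * d" for k
    proof (induction k)
      case 0
      then show ?case using is_subringD(2)[OF V(1)] by (intro bexI[of _ 0]) auto
    next
      case (Suc k)
      then obtain d where d: "d \<in> V" "g ^ k = 1 - t * d" by auto
      have "g ^ Suc k = g ^ k - t * a * g ^ k" unfolding g_def by (simp add: algebra_simps)
      also have "\<dots> = 1 - t * (d + a * g ^ k)" unfolding d(2) by (simp add: algebra_simps)
      finally show ?case using d gV a by (meson is_subringD V(1))
    qed
    then obtain d where d: "d \<in> V" "g ^ n = 1 - t * d" by blast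
    have "t * d * inverse t = d" using commV[OF tF d(1)] V(4) by (simp add: mult.assoc)
    then have "g ^ n * inverse t = inverse t - d" unfolding d(2) by (simp add: left_diff_distrib)
    then have "inverse t = g ^ n * inverse t + d" by simp
    then show False using c d(1) V(5) is_subringD(6)[OF V(1)] by metis
  qed
  \<comment> \<open>Induction on the sum of the degrees: the larger one can be lowered, and
    \<open>x\<close> and \<open>inverse x\<close> play symmetric roles.\<close>
  have descent: False if "x \<in> F" "x \<noteq> 0" "inverse t \<in> polys V x n" "inverse t \<in> polys V (inverse x) m"
    for x n m
    using that
  proof (induction "n + m" arbitrary: n m x rule: less_induct)
    case less
    have main: False
      if le: "m \<le> n" and xF: "x \<in> F" and x0: "x \<noteq> 0" and n: "inverse t \<in> polys V x n"
        and m: "inverse t \<in> polys V (inverse x) m" and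
        IH: "\<And>n'. n' < n \<Longrightarrow> inverse t \<in> polys V x n' \<Longrightarrow> False"
      for n m x
    proof (cases m)
      case 0
      then show False using m V(5) by simp
    next
      case (Suc m')
      then obtain n' where n': "n = Suc n'" using le by (cases n) auto
      define y where "y = inverse x"
      have yF: "y \<in> F" unfolding y_def using division_subring_inverse[OF F xF] .
      obtain d r where dr: "d \<in> V" "r \<in> polys V y m'" "inverse t = d + y * r"
        using m Suc unfolding y_def by (auto elim: polys_SucE)
      \<comment> \<open>The constant term \<open>d\<close> is absorbed by the unit \<open>g\<close>,
        which leaves \<open>1 = t * (y * r')\<close> with no constant term in
        \<open>y\<close>.\<close>
      define g where "g = 1 - t * d"
      have g: "inverse g \<in> V" using unit[OF dr(1)] unfolding g_def .
      have "t * inverse t = t * d + t * (y * r)" unfolding dr(3) by (simp add: distrib_left)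
      then have "g = t * (y * r)" unfolding g_def using V(4) by (simp add: algebra_simps)
      moreover have "g \<noteq> 0"
        unfolding g_def using V(4,5) dr(1) by (metis eq_iff_diff_eq_0 inverse_unique)
      ultimately have "1 = inverse g * (t * (y * r))" by (metis left_inverse)
      moreover have gt: "inverse g * t = t * inverse g" "inverse g * y = y * inverse g"
        using commV[OF tF g] commV[OF yF g] by auto
      ultimately have one: "1 = t * (y * (inverse g * r))" by (metis mult.assoc)
      define r' where "r' = inverse g * r"
      have r': "r' \<in> polys V y m'" unfolding r'_def by (rule polys_scale[OF V(1) commV[OF yF] g dr(2)])
      have "inverse y ^ m' * r' \<in> polys V (inverse y) m'"
        using polys_reverse[OF V(1) commV[OF yF] _ r'] x0 unfolding y_def by auto
      then have xr: "x ^ m' * r' \<in> polys V x m'" unfolding y_def by simp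
      have shift: "x ^ k * s \<in> polys V x (k + l)" if "s \<in> polys V x l" for k l s
        using that by (induction k) (auto simp: mult.assoc intro: polys_mult_x[OF V(1)])
      define w where "w = x ^ n' * r'"
      have "w = x ^ (n' - m') * (x ^ m' * r')"
        unfolding w_def using le Suc n' by (simp flip: mult.assoc power_add)
      then have w: "w \<in> polys V x n'" using shift[OF xr, of "n' - m'"] le Suc n' by simp
      \<comment> \<open>Multiplying this relation by \<open>x ^ Suc n'\<close> expresses that power
        by lower ones, which then replace the leading term in the expansion of
        \<open>inverse t\<close>.\<close>
      have "x ^ Suc n' = x ^ Suc n' * (t * (y * r'))" using one unfolding r'_def by simp
      also have "\<dots> = t * (x ^ Suc n' * (y * r'))"
        using commF[OF division_subringD(7)[OF F xF, of "Suc n'"] tF] by (metis mult.assoc)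
      also have "x ^ Suc n' * (y * r') = w"
        unfolding w_def y_def using x0
        by (subst power_Suc2) (simp add: mult.assoc flip: mult.assoc[of x "inverse x"])
      finally have xn: "x ^ Suc n' = t * w" .
      obtain s c where s: "s \<in> polys V x n'" "c \<in> V" "inverse t = s + c * x ^ Suc n'"
        using polys_top_coeff[OF V(1) commV[OF xF]] n n' by blast
      have "inverse t = s + (c * t) * w" using s(3) xn by (simp add: mult.assoc)
      also have "\<dots> \<in> polys V x n'"
        using polys_add[OF V(1) s(1)] polys_scale[OF V(1) commV[OF xF] _ w]
          is_subringD(4)[OF V(1) s(2) V(3)] by blast
      finally show False using IH n' by blast
    qed
    show False
    proof (cases "m \<le> n")
      case True
      show ?thesis
      proof (rule main[OF True less.prems])
        show False if "n' < n" "inverse t \<in> polys V x n'" for n'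
          using less.hyps[of n' m x] less.prems that by auto
      qed
    next
      case False
      have x': "inverse x \<in> F" "inverse x \<noteq> 0" "inverse t \<in> polys V (inverse (inverse x)) n"
        using division_subring_inverse[OF F less.prems(1)] less.prems by auto
      show ?thesis
      proof (rule main[OF _ x'(1,2) less.prems(4) x'(3)])
        show False if "n' < m" "inverse t \<in> polys V (inverse x) n'" for n'
          using less.hyps[of n' n "inverse x"] x' that by auto
      qed (use False in auto)
    qed
  qed
  have "f \<in> V \<or> inverse f \<in> V" if f: "f \<in> F" for f
  proof (rule ccontr)
    assume no: "\<not> ?thesis"
    then have f0: "f \<noteq> 0" using is_subringD(2)[OF V(1)] by auto
    obtain n where "inverse t \<in> polys V f n" using adj[OF f] no unfolding adjoin_def by auto
    moreover obtain m where "inverse t \<in> polys V (inverse f) m"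
      using adj[OF division_subring_inverse[OF F f]] no unfolding adjoin_def by auto
    ultimately show False using descent[OF f f0] by blast
  qed
  then show ?thesis unfolding valuation_subring_def using V by auto
qed

text \<open>Zorn's lemma for the subrings of \<open>F\<close> that contain \<open>t\<close> but not
  its inverse; the hypothesis on \<open>adjoin \<int> t\<close> makes this family nonempty.\<close>

lemma valuation_subring_exists:
  fixes F :: "'a::division_ring set"
  assumes F: "division_subring F" and commF: "\<And>x y. x \<in> F \<Longrightarrow> y \<in> F \<Longrightarrow> x * y = y * x"
    and t: "t \<in> F" "t \<noteq> 0" "inverse t \<notin> adjoin \<int> t"
  obtains V where "valuation_subring F V" "t \<in> V" "inverse t \<notin> V"
proof -
  define \<A> where "\<A> = {A. is_subring A \<and> A \<subseteq> F \<and> t \<in> A \<and> inverse t \<notin> A}"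
  have "adjoin \<int> t \<in> \<A>"
    unfolding \<A>_def using t is_subring_adjoin[OF is_subring_Ints Ints_commute] adjoin_self[OF is_subring_Ints]
      adjoin_least[OF division_subring_is_subring[OF F], of \<int> t] subring_of_int[OF division_subring_is_subring[OF F]]
    by (auto elim!: Ints_cases)
  then have ne: "\<A> \<noteq> {}" by auto
  have "\<Union>\<C> \<in> \<A>" if ch: "\<C> \<noteq> {}" "subset.chain \<A> \<C>" for \<C>
  proof -
    have sub: "\<C> \<subseteq> \<A>" and tot: "\<And>X Y. X \<in> \<C> \<Longrightarrow> Y \<in> \<C> \<Longrightarrow> X \<subseteq> Y \<or> Y \<subseteq> X"
      using ch(2) unfolding subset_chain_def by auto
    have "is_subring (\<Union>\<C>)"
      unfolding is_subring_def
    proof (intro conjI ballI)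
      show "1 \<in> \<Union>\<C>" using ch(1) sub is_subringD(1) unfolding \<A>_def by fastforce
    next
      fix x y assume "x \<in> \<Union>\<C>" "y \<in> \<Union>\<C>"
      then obtain Z where "Z \<in> \<C>" "x \<in> Z" "y \<in> Z" using tot by blast
      moreover from this have "is_subring Z" using sub unfolding \<A>_def by auto
      ultimately show "x - y \<in> \<Union>\<C>" "x * y \<in> \<Union>\<C>" using is_subringD(3,4) by blast+
    qed
    then show ?thesis using ch(1) sub unfolding \<A>_def by blast
  qed
  from subset_Zorn_nonempty[OF ne this] obtain V where V: "V \<in> \<A>"
    and max: "\<And>X. X \<in> \<A> \<Longrightarrow> V \<subseteq> X \<Longrightarrow> X = V" by blast
  have "valuation_subring F V"
    by (rule valuation_subring_if_maximal[OF F commF, of V t]) (use V t max in \<open>auto simp: \<A>_def\<close>)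
  then show thesis using that V unfolding \<A>_def by auto
qed

section \<open>Coordinates over the center and orders over a valuation ring\<close>

lemma coordinates:
  fixes E :: "'a::division_ring set"
  assumes E: "division_subring E" and fin: "fin_dim_over_center E"
  obtains B and co :: "'a \<Rightarrow> 'a \<Rightarrow> 'a" where "finite B" "B \<subseteq> E"
    "\<And>x b. x \<in> E \<Longrightarrow> b \<in> B \<Longrightarrow> co x b \<in> center_of E"
    "\<And>x. x \<in> E \<Longrightarrow> x = (\<Sum>b\<in>B. co x b * b)"
    "\<And>x y b. x \<in> E \<Longrightarrow> y \<in> E \<Longrightarrow> b \<in> B \<Longrightarrow> co (x + y) b = co x b + co y b"
    "\<And>f x b. f \<in> center_of E \<Longrightarrow> x \<in> E \<Longrightarrow> b \<in> B \<Longrightarrow> co (f * x) b = f * co x b"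
    "\<And>b b'. b \<in> B \<Longrightarrow> b' \<in> B \<Longrightarrow> co b b' = (if b = b' then 1 else 0)"
proof -
  define F where "F = center_of E"
  have F: "is_subring F" "\<And>f. f \<in> F \<Longrightarrow> inverse f \<in> F"
    unfolding F_def using division_subring_center[OF E] division_subring_is_subring division_subring_inverse by auto
  define rep where "rep B x c \<longleftrightarrow> (\<forall>b\<in>B. c b \<in> F) \<and> x = (\<Sum>b\<in>B. c b * b)" for B x and c :: "'a \<Rightarrow> 'a"
  define spans where "spans B \<longleftrightarrow> finite B \<and> B \<subseteq> E \<and> (\<forall>x\<in>E. \<exists>c. rep B x c)" for B
  have "\<exists>B. spans B" using fin unfolding spans_def rep_def F_def fin_dim_over_center_def by blast
  \<comment> \<open>A spanning set of least cardinality is a basis: a nontrivial relation would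
    express one member by the others.\<close>
  then obtain B where B: "spans B" and least: "\<And>B'. spans B' \<Longrightarrow> card B \<le> card B'"
    using arg_min_nat_lemma[of spans _ card] by metis
  have B': "finite B" "B \<subseteq> E" using B unfolding spans_def by auto
  have indep: "c b0 = 0" if c: "rep B 0 c" and b0: "b0 \<in> B" for c b0
  proof (rule ccontr)
    assume nz: "c b0 \<noteq> 0"
    define u where "u = inverse (c b0)"
    have u: "u \<in> F" using c b0 F(2) unfolding u_def rep_def by auto
    have "0 = c b0 * b0 + (\<Sum>b\<in>B - {b0}. c b * b)"
      using c sum.remove[OF B'(1) b0, of "\<lambda>b. c b * b"] unfolding rep_def by simp
    then have "u * (c b0 * b0) = - (u * (\<Sum>b\<in>B - {b0}. c b * b))"
      by (metis eq_neg_iff_add_eq_0 mult_minus_right)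
    then have b0_eq: "b0 = - (u * (\<Sum>b\<in>B - {b0}. c b * b))"
      using nz unfolding u_def by (simp flip: mult.assoc)
    have "spans (B - {b0})"
      unfolding spans_def
    proof (intro conjI ballI)
      fix x assume "x \<in> E"
      then obtain e where e: "rep B x e" using B unfolding spans_def by auto
      have "x = e b0 * b0 + (\<Sum>b\<in>B - {b0}. e b * b)"
        using e sum.remove[OF B'(1) b0, of "\<lambda>b. e b * b"] unfolding rep_def by simp
      also have "\<dots> = (\<Sum>b\<in>B - {b0}. (e b - e b0 * u * c b) * b)"
        by (subst b0_eq) (simp add: left_diff_distrib sum_subtractf sum_distrib_left mult.assoc)
      finally have "rep (B - {b0}) x (\<lambda>b. e b - e b0 * u * c b)"
        unfolding rep_def using e c u b0
        by (auto simp: rep_def intro!: is_subringD(3)[OF F(1)] is_subringD(4)[OF F(1)])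
      then show "\<exists>c. rep (B - {b0}) x c" by blast
    qed (use B' in auto)
    then show False using least[of "B - {b0}"] card_Diff1_less[OF B'(1) b0] by simp
  qed
  have uniq: "c b = e b" if "rep B x c" "rep B x e" "b \<in> B" for c e x b
  proof -
    have "rep B 0 (\<lambda>b. c b - e b)"
      using that(1,2) is_subringD(3)[OF F(1)] unfolding rep_def left_diff_distrib sum_subtractf
      by (metis diff_self)
    then show ?thesis using indep that(3) by fastforce
  qed
  define co where "co x = (SOME c. rep B x c)" for x
  have co: "rep B x (co x)" if "x \<in> E" for x
    using B that someI_ex[of "rep B x"] unfolding spans_def co_def by auto
  show thesis
  proof (rule that[of B co])
    fix x y b assume x: "x \<in> E" and y: "y \<in> E" and b: "b \<in> B"
    have "rep B (x + y) (\<lambda>b. co x b + co y b)"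
      using co[OF x] co[OF y] is_subringD(6)[OF F(1)] unfolding rep_def distrib_right sum.distrib
      by metis
    then show "co (x + y) b = co x b + co y b"
      using uniq[OF co] x y b division_subringD(6)[OF E] by blast
  next
    fix f x b assume f: "f \<in> center_of E" and x: "x \<in> E" and b: "b \<in> B"
    have "f * x = f * (\<Sum>b\<in>B. co x b * b)" using co[OF x] unfolding rep_def by metis
    then have "f * x = (\<Sum>b\<in>B. (f * co x b) * b)" by (simp add: sum_distrib_left mult.assoc)
    then have "rep B (f * x) (\<lambda>b. f * co x b)"
      using co[OF x] f is_subringD(4)[OF F(1)] unfolding rep_def F_def[symmetric] by blast
    then show "co (f * x) b = f * co x b"
      using uniq[OF co] x b f center_ofD(1) division_subringD(4)[OF E] by metis
  next
    fix b b' assume b: "b \<in> B" "b' \<in> B"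
    have "(\<Sum>a\<in>B. (if b = a then 1 else 0) * a) = (\<Sum>a\<in>B. if b = a then a else 0)"
      by (rule sum.cong) auto
    then have "rep B b (\<lambda>b'. if b = b' then 1 else 0)"
      unfolding rep_def using b B'(1) is_subringD(1,2)[OF F(1)] by auto
    then show "co b b' = (if b = b' then 1 else 0)"
      using uniq[OF co _ b(2)] b(1) B'(2) by blast
  next
    fix x b assume "x \<in> E" "b \<in> B"
    then show "co x b \<in> center_of E" using co unfolding rep_def F_def by blast
  next
    fix x assume "x \<in> E"
    then show "x = (\<Sum>b\<in>B. co x b * b)" using co unfolding rep_def by blast
  qed (use B' in auto)
qed

text \<open>A valuation ring makes any two nonzero elements of \<open>F\<close> comparable under
  divisibility, so a finite set has a member dividing all the others.\<close>

lemma valuation_max: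
  fixes F :: "'a::division_ring set"
  assumes V: "valuation_subring F V" and F: "division_subring F"
    and "finite G" "G \<noteq> {}" "G \<subseteq> F - {0}"
  shows "\<exists>p\<in>G. \<forall>g\<in>G. inverse p * g \<in> V"
  using assms(3-5)
proof (induction G rule: finite_ne_induct)
  case (singleton x)
  then show ?case using V is_subringD(1) unfolding valuation_subring_def by auto
next
  case (insert g G)
  then obtain p where p: "p \<in> G" "\<And>h. h \<in> G \<Longrightarrow> inverse p * h \<in> V" by blast
  have Vr: "is_subring V" using V unfolding valuation_subring_def by auto
  have nz: "p \<noteq> 0" "g \<noteq> 0" "p \<in> F" "g \<in> F" using p insert by auto
  have "inverse p * g \<in> F" using nz F division_subringD by metis
  then consider "inverse p * g \<in> V" | "inverse (inverse p * g) \<in> V"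
    using V unfolding valuation_subring_def by blast
  then show ?case
  proof cases
    case 1
    then show ?thesis using p by auto
  next
    case 2
    then have gp: "inverse g * p \<in> V" using nz by (simp add: nonzero_inverse_mult_distrib)
    have "inverse g * h \<in> V" if "h \<in> G" for h
    proof -
      have "inverse g * h = (inverse g * p) * (inverse p * h)"
        using nz by (simp add: mult.assoc flip: mult.assoc[of p])
      then show ?thesis using is_subringD(4)[OF Vr gp p(2)[OF that]] by simp
    qed
    moreover have "inverse g * g \<in> V" using nz is_subringD(1)[OF Vr] by simp
    ultimately show ?thesis by blast
  qed
qed

lemma coordinates_sum:
  fixes co :: "'a::division_ring \<Rightarrow> 'a \<Rightarrow> 'a"
  assumes E: "division_subring E"
    and add: "\<And>x y. x \<in> E \<Longrightarrow> y \<in> E \<Longrightarrow> co (x + y) b = co x b + co y b"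
    and g: "\<And>i. i \<in> I \<Longrightarrow> g i \<in> E"
  shows "co (sum g I) b = (\<Sum>i\<in>I. co (g i) b)"
proof -
  have 0: "co 0 b = 0" using add[of 0 0] division_subringD(2)[OF E] by simp
  show ?thesis using g
    by (induction I rule: infinite_finite_induct)
      (auto simp: 0 add subring_sum[OF division_subring_is_subring[OF E]])
qed

text \<open>\<open>R\<close> is the left order of the \<open>V\<close>-lattice spanned by a basis; \<open>p\<close> below is a coefficient
  of maximal valuation of left multiplication by \<open>d\<close>.\<close>

lemma valuation_order_exists:
  fixes E :: "'a::division_ring set"
  assumes E: "division_subring E" and fin: "fin_dim_over_center E"
    and V: "valuation_subring (center_of E) V"
  obtains R where "is_subring R" "R \<subseteq> E" "V \<subseteq> R"
    "\<And>d. d \<in> E \<Longrightarrow> d \<noteq> 0 \<Longrightarrow> \<exists>p\<in>center_of E. p \<noteq> 0 \<and> inverse p * d \<in> R \<and>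
       (\<forall>u\<in>center_of E. \<forall>r\<in>R. inverse u \<notin> V \<longrightarrow> d \<noteq> p * u * r)"
proof -
  define F where "F = center_of E"
  have F: "division_subring F" unfolding F_def by (rule division_subring_center[OF E])
  obtain B co where B: "finite B" "B \<subseteq> E"
    and coF: "\<And>x b. x \<in> E \<Longrightarrow> b \<in> B \<Longrightarrow> co x b \<in> F"
    and rep: "\<And>x. x \<in> E \<Longrightarrow> x = (\<Sum>b\<in>B. co x b * b)"
    and add: "\<And>x y b. x \<in> E \<Longrightarrow> y \<in> E \<Longrightarrow> b \<in> B \<Longrightarrow> co (x + y) b = co x b + co y b"
    and scale: "\<And>f x b. f \<in> F \<Longrightarrow> x \<in> E \<Longrightarrow> b \<in> B \<Longrightarrow> co (f * x) b = f * co x b"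
    and unit: "\<And>b b'. b \<in> B \<Longrightarrow> b' \<in> B \<Longrightarrow> co b b' = (if b = b' then 1 else 0)"
    by (rule coordinates[OF E fin, folded F_def]) (rule that)
  have Vr: "is_subring V" and VF: "V \<subseteq> F" using V unfolding valuation_subring_def F_def by auto
  have FE: "F \<subseteq> E" unfolding F_def center_of_def by auto
  note Em = division_subringD(4)[OF E]
  define R where "R = {r\<in>E. \<forall>b\<in>B. \<forall>b'\<in>B. co (r * b) b' \<in> V}"
  show thesis
  proof (rule that[of R])
    show "R \<subseteq> E" unfolding R_def by auto
    show VR: "V \<subseteq> R"
    proof
      fix v assume v: "v \<in> V"
      have "co (v * b) b' \<in> V" if "b \<in> B" "b' \<in> B" for b b'
      proof -
        have "v \<in> F" "b \<in> E" using v VF B(2) that by auto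
        then show ?thesis using v scale[of v b b'] that unit[of b b'] is_subringD(2)[OF Vr] by auto
      qed
      then show "v \<in> R" unfolding R_def using v VF FE by auto
    qed
    show "is_subring R"
      unfolding is_subring_def
    proof (intro conjI ballI)
      show "1 \<in> R" using VR is_subringD(1)[OF Vr] by auto
    next
      fix r s assume rs: "r \<in> R" "s \<in> R"
      then have E': "r \<in> E" "s \<in> E" unfolding R_def by auto
      have "- 1 \<in> F" using division_subringD[OF F] by metis
      have "co ((r - s) * b) b' \<in> V" if b: "b \<in> B" "b' \<in> B" for b b'
      proof -
        have bE: "b \<in> E" using B b by auto
        have "co ((r - s) * b) b' = co (r * b + (-1) * (s * b)) b'" by (simp add: algebra_simps)
        also have "\<dots> = co (r * b) b' + co ((-1) * (s * b)) b'"
          by (rule add[OF Em[OF E'(1) bE] _ b(2)])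
            (use Em[OF E'(2) bE] division_subringD(5)[OF E] in auto)
        also have "co ((-1) * (s * b)) b' = - co (s * b) b'"
          using scale[OF \<open>- 1 \<in> F\<close> Em[OF E'(2) bE] b(2)] by simp
        finally have "co ((r - s) * b) b' = co (r * b) b' - co (s * b) b'" by simp
        then show ?thesis using rs b is_subringD(3)[OF Vr] unfolding R_def by auto
      qed
      then show "r - s \<in> R" unfolding R_def using E' division_subringD(3)[OF E] by auto
      have "co (r * s * b) b' \<in> V" if b: "b \<in> B" "b' \<in> B" for b b'
      proof -
        have bE: "b \<in> E" using B b by auto
        have sb: "s * b \<in> E" by (rule Em[OF E'(2) bE])
        have "r * s * b = r * (\<Sum>k\<in>B. co (s * b) k * k)" by (simp add: mult.assoc flip: rep[OF sb])
        also have "\<dots> = (\<Sum>k\<in>B. co (s * b) k * (r * k))"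
          unfolding sum_distrib_left
        proof (rule sum.cong[OF refl])
          fix k assume "k \<in> B"
          then have "co (s * b) k * r = r * co (s * b) k"
            using coF[OF sb] center_ofD(2)[OF _ E'(1)] unfolding F_def by auto
          then show "r * (co (s * b) k * k) = co (s * b) k * (r * k)" by (metis mult.assoc)
        qed
        finally have "co (r * s * b) b' = co (\<Sum>k\<in>B. co (s * b) k * (r * k)) b'" by simp
        also have "\<dots> = (\<Sum>k\<in>B. co (co (s * b) k * (r * k)) b')"
        proof (rule coordinates_sum[OF E])
          show "co (x + y) b' = co x b' + co y b'" if "x \<in> E" "y \<in> E" for x y using add that b(2) by blast
          show "co (s * b) k * (r * k) \<in> E" if "k \<in> B" for k
            using coF[OF sb that] FE E' B(2) that Em by blast
        qed
        also have "\<dots> = (\<Sum>k\<in>B. co (s * b) k * co (r * k) b')"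
          by (rule sum.cong[OF refl], rule scale[OF coF[OF sb] _ b(2)]) (use E' B(2) Em in auto)
        also have "\<dots> \<in> V"
          by (rule subring_sum[OF Vr], rule is_subringD(4)[OF Vr]) (use rs b in \<open>auto simp: R_def\<close>)
        finally show ?thesis .
      qed
      then show "r * s \<in> R" unfolding R_def using E' Em by auto
    qed
  next
    fix d assume d: "d \<in> E" "d \<noteq> 0"
    define G where "G = (\<lambda>(b, b'). co (d * b) b') ` (B \<times> B) - {0}"
    have dB: "d * b \<in> E" if "b \<in> B" for b using d B that Em by auto
    \<comment> \<open>If all coefficients vanished, then, \<open>d\<close> being invertible, every
      basis element and hence 1 would be 0.\<close>
    have "G \<noteq> {}"
    proof
      assume "G = {}"
      then have co0: "co (d * b) b' = 0" if "b \<in> B" "b' \<in> B" for b b' using that unfolding G_def by auto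
      have "d * b = 0" if "b \<in> B" for b by (subst rep[OF dB[OF that]]) (simp add: co0 that)
      then have "b = 0" if "b \<in> B" for b using d that by auto
      then have "(\<Sum>b\<in>B. co 1 b * b) = 0" by (intro sum.neutral) auto
      then show False using rep[OF division_subringD(1)[OF E]] by (metis zero_neq_one)
    qed
    moreover have "finite G" "G \<subseteq> F - {0}" unfolding G_def using B(1) coF[OF dB] by auto
    ultimately obtain p where p: "p \<in> G" and pV: "\<And>g. g \<in> G \<Longrightarrow> inverse p * g \<in> V"
      using valuation_max[OF V[folded F_def] F] by meson
    then obtain b b' where b: "b \<in> B" "b' \<in> B" "p = co (d * b) b'" "p \<noteq> 0" "p \<in> F"
      unfolding G_def using coF[OF dB] by auto
    have ip: "inverse p \<in> F" using b division_subring_inverse[OF F] by auto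
    have "co (inverse p * d * c) c' \<in> V" if c: "c \<in> B" "c' \<in> B" for c c'
    proof -
      have "co (inverse p * d * c) c' = inverse p * co (d * c) c'"
        using scale[OF ip dB[OF c(1)] c(2)] by (simp add: mult.assoc)
      moreover have "co (d * c) c' \<in> G" if "co (d * c) c' \<noteq> 0"
        unfolding G_def using c that by (auto intro: image_eqI[of _ _ "(c, c')"])
      ultimately show ?thesis
        using pV is_subringD(2)[OF Vr] by (cases "co (d * c) c' = 0") auto
    qed
    then have "inverse p * d \<in> R" unfolding R_def using ip FE d Em by auto
    \<comment> \<open>Comparing the coordinate that equals \<open>p\<close> on both sides gives
      \<open>u * co (r * b) b' = 1\<close>, so \<open>inverse u\<close> would be a matrix entry of
      \<open>r\<close>, an element of \<open>V\<close>.\<close>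
    moreover have "d \<noteq> p * u * r" if u: "u \<in> F" "r \<in> R" "inverse u \<notin> V" for u r
    proof
      assume eq: "d = p * u * r"
      have rb: "r * b \<in> E" using u(2) b(1) B(2) Em unfolding R_def by auto
      have "p = co ((p * u) * (r * b)) b'" unfolding b(3)[symmetric] using b(3) eq by (simp add: mult.assoc)
      also have "\<dots> = p * u * co (r * b) b'"
        by (rule scale[OF _ rb b(2)]) (use b u division_subringD(4)[OF F] in auto)
      finally have "p * 1 = p * (u * co (r * b) b')" by (simp add: mult.assoc)
      then have "u * co (r * b) b' = 1" using b(4) by (metis mult_left_cancel)
      then have "inverse u = co (r * b) b'" by (rule inverse_unique)
      then show False using u(2,3) b unfolding R_def by auto
    qed
    ultimately show "\<exists>p\<in>center_of E. p \<noteq> 0 \<and> inverse p * d \<in> R \<and>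
       (\<forall>u\<in>center_of E. \<forall>r\<in>R. inverse u \<notin> V \<longrightarrow> d \<noteq> p * u * r)"
      using b unfolding F_def by blast
  qed
qed

text \<open>Left multiplication by \<open>d\<close> has finitely many coefficients, all torsion or
  zero, so they lie in a finite subring. The coordinates of all powers of \<open>d\<close> stay
  there, which leaves finitely many powers.\<close>

lemma torsion_if_center_torsion:
  fixes E :: "'a::division_ring set"
  assumes E: "division_subring E" and fin: "fin_dim_over_center E" and char: "CHAR('a) > 0"
    and tors: "\<And>f. f \<in> center_of E \<Longrightarrow> f \<noteq> 0 \<Longrightarrow> torsion f"
    and d: "d \<in> E" "d \<noteq> 0"
  shows "torsion d"
proof -
  define F where "F = center_of E"
  obtain B co where B: "finite B" "B \<subseteq> E"
    and coF: "\<And>x b. x \<in> E \<Longrightarrow> b \<in> B \<Longrightarrow> co x b \<in> F"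
    and rep: "\<And>x. x \<in> E \<Longrightarrow> x = (\<Sum>b\<in>B. co x b * b)"
    and add: "\<And>x y b. x \<in> E \<Longrightarrow> y \<in> E \<Longrightarrow> b \<in> B \<Longrightarrow> co (x + y) b = co x b + co y b"
    and scale: "\<And>f x b. f \<in> F \<Longrightarrow> x \<in> E \<Longrightarrow> b \<in> B \<Longrightarrow> co (f * x) b = f * co x b"
    and "\<And>b b'. b \<in> B \<Longrightarrow> b' \<in> B \<Longrightarrow> co b b' = (if b = b' then 1 else 0)"
    by (rule coordinates[OF E fin, folded F_def]) (rule that)
  note Em = division_subringD(4)[OF E]
  have FE: "F \<subseteq> E" unfolding F_def center_of_def by auto
  have dB: "d * b \<in> E" if "b \<in> B" for b using d B that Em by auto
  \<comment> \<open>The coordinates of 1 are included to start the induction over the powers of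
    \<open>d\<close>.\<close>
  define S where "S = (\<lambda>(b, b'). co (d * b) b') ` (B \<times> B) \<union> (\<lambda>b. co 1 b) ` B"
  have SF: "S \<subseteq> F" unfolding S_def using coF[OF dB] coF[OF division_subringD(1)[OF E]] by auto
  have "\<exists>A. finite A \<and> is_subring A \<and> S \<subseteq> A \<and> (\<forall>B. is_subring B \<longrightarrow> S \<subseteq> B \<longrightarrow> A \<subseteq> B)"
  proof (rule finite_subring_of_torsion[OF char])
    show "finite S" unfolding S_def using B by auto
    show "torsion x \<or> x = 0" if "x \<in> S" for x using tors SF that unfolding F_def by auto
    show "x * y = y * x" if "x \<in> S" "y \<in> S" for x y
      using SF that center_ofD unfolding F_def by blast
  qed
  then obtain A where A: "finite A" "is_subring A" "S \<subseteq> A" by blast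
  define M where "M = (\<lambda>c. \<Sum>b\<in>B. c b * b) ` (B \<rightarrow>\<^sub>E A)"
  have "finite M" unfolding M_def using A(1) B(1) by (intro finite_imageI finite_PiE) auto
  have coA: "co (d ^ n) b \<in> A" if "b \<in> B" for n b
    using that
  proof (induction n arbitrary: b)
    case 0
    then show ?case using A(3) unfolding S_def by auto
  next
    case (Suc n)
    have dn: "d ^ n \<in> E" using d division_subringD(7)[OF E] by auto
    have "d ^ Suc n = d * (\<Sum>k\<in>B. co (d ^ n) k * k)" by (simp flip: rep[OF dn])
    also have "\<dots> = (\<Sum>k\<in>B. co (d ^ n) k * (d * k))"
      unfolding sum_distrib_left
    proof (rule sum.cong[OF refl])
      fix k assume "k \<in> B"
      then have "co (d ^ n) k * d = d * co (d ^ n) k"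
        using coF[OF dn] center_ofD(2)[OF _ d(1)] unfolding F_def by auto
      then show "d * (co (d ^ n) k * k) = co (d ^ n) k * (d * k)" by (metis mult.assoc)
    qed
    finally have "co (d ^ Suc n) b = co (\<Sum>k\<in>B. co (d ^ n) k * (d * k)) b" by simp
    also have "\<dots> = (\<Sum>k\<in>B. co (co (d ^ n) k * (d * k)) b)"
    proof (rule coordinates_sum[OF E])
      show "co (x + y) b = co x b + co y b" if "x \<in> E" "y \<in> E" for x y using add that Suc.prems by blast
      show "co (d ^ n) k * (d * k) \<in> E" if "k \<in> B" for k
        using coF[OF dn that] FE dB[OF that] Em by blast
    qed
    also have "\<dots> = (\<Sum>k\<in>B. co (d ^ n) k * co (d * k) b)"
      by (rule sum.cong[OF refl], rule scale[OF coF[OF dn] dB Suc.prems])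
    also have "\<dots> \<in> A"
    proof (rule subring_sum[OF A(2)], rule is_subringD(4)[OF A(2)])
      fix k assume "k \<in> B"
      then show "co (d ^ n) k \<in> A" "co (d * k) b \<in> A"
        using Suc A(3) unfolding S_def by auto
    qed
    finally show ?case .
  qed
  have "d ^ n \<in> M" for n
  proof -
    have dn: "d ^ n \<in> E" using d division_subringD(7)[OF E] by auto
    have "restrict (co (d ^ n)) B \<in> B \<rightarrow>\<^sub>E A" using coA by auto
    moreover have "d ^ n = (\<Sum>b\<in>B. restrict (co (d ^ n)) B b * b)" by (simp flip: rep[OF dn])
    ultimately show ?thesis unfolding M_def by blast
  qed
  then show ?thesis using torsion_if_finite_powers[OF \<open>finite M\<close> _ d(2)] by blast
qed

section \<open>Elements congruent to 1 in an order\<close>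

text \<open>The last clause gives every \<open>d\<close> a content \<open>p\<close>: the element
  \<open>inverse p * d\<close> of \<open>R\<close> is primitive, that is, not divisible in
  \<open>R\<close> by a nonunit of \<open>V\<close>. For a valuation ring \<open>V\<close>,
  \<open>inverse u \<notin> V\<close> says that \<open>u\<close> is a nonzero nonunit; 0 is excluded
  because \<open>inverse 0 = 0\<close>.\<close>

definition valuation_order :: "'a::division_ring set \<Rightarrow> 'a set \<Rightarrow> 'a set \<Rightarrow> bool" where
  "valuation_order E V R \<longleftrightarrow> is_subring R \<and> R \<subseteq> E \<and> V \<subseteq> R \<and>
     (\<forall>d\<in>E. d \<noteq> 0 \<longrightarrow> (\<exists>p\<in>center_of E. p \<noteq> 0 \<and> inverse p * d \<in> R \<and>
       (\<forall>u\<in>center_of E. \<forall>r\<in>R. inverse u \<notin> V \<longrightarrow> d \<noteq> p * u * r)))"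

lemma near_one_power:
  assumes R: "is_subring R" and s: "s \<in> R" "\<And>x. x \<in> R \<Longrightarrow> s * x = x * s" and r: "r \<in> R"
  shows "\<exists>q\<in>R. (1 + s * r) ^ n = 1 + s * q"
proof (induction n)
  case 0
  then show ?case using is_subringD(2)[OF R] by (intro bexI[of _ 0]) auto
next
  case (Suc n)
  then obtain q where q: "q \<in> R" "(1 + s * r) ^ n = 1 + s * q" by blast
  have "(1 + s * r) ^ Suc n = 1 + s * (q + r + r * (s * q))"
    using q(2) by (simp add: algebra_simps)
  moreover have "q + r + r * (s * q) \<in> R" using q r s R by (meson is_subringD)
  ultimately show ?case by blast
qed

text \<open>Modulo \<open>p * s * R\<close>, the commutator with \<open>e\<close> sees the \<open>n\<close>-th power only through the factor \<open>n\<close>.\<close>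

lemma near_one_power_commutator:
  assumes R: "is_subring R" and s: "s \<in> R" "\<And>x. x \<in> R \<Longrightarrow> s * x = x * s" and r: "r \<in> R"
    and d: "d \<in> R" "s * r * e - e * (s * r) = p * d"
    and p: "\<And>x. x \<in> R \<Longrightarrow> p * x = x * p"
  shows "\<exists>w\<in>R. (1 + s * r) ^ n * e - e * (1 + s * r) ^ n = of_nat n * (p * d) + p * s * w"
proof (induction n)
  case 0
  then show ?case using is_subringD(2)[OF R] by (intro bexI[of _ 0]) auto
next
  case (Suc n)
  define y where "y = 1 + s * r"
  have yR: "y \<in> R" unfolding y_def using R s r by (meson is_subringD)
  obtain w where w: "w \<in> R" "y ^ n * e - e * y ^ n = of_nat n * (p * d) + p * s * w"
    using Suc unfolding y_def by blast
  obtain q where q: "q \<in> R" "y ^ n = 1 + s * q"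
    using near_one_power[OF R s r] unfolding y_def by blast
  have ye: "y * e - e * y = p * d" using d(2) unfolding y_def by (simp add: algebra_simps)
  have ps: "y * (p * s * w) = p * s * (y * w)"
    using p[OF yR] s(2)[OF yR] p[OF s(1)] by (metis mult.assoc)
  have "s * r * (of_nat n * (p * d)) = of_nat n * (s * r * p * d)"
    by (metis mult.assoc mult_of_nat_commute)
  also have "s * r * p * d = p * s * (r * d)"
    using p[OF is_subringD(4)[OF R s(1) r]] by (metis mult.assoc)
  finally have 1: "s * r * (of_nat n * (p * d)) = p * s * (of_nat n * (r * d))"
    by (metis mult.assoc mult_of_nat_commute)
  have 2: "p * d * (s * q) = p * s * (d * q)" using s(2)[OF d(1)] by (metis mult.assoc)
  have "y ^ Suc n * e - e * y ^ Suc n = y * (y ^ n * e - e * y ^ n) + (y * e - e * y) * y ^ n"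
    by (simp add: algebra_simps)
  also have "\<dots> = y * (of_nat n * (p * d)) + y * (p * s * w) + p * d * (1 + s * q)"
    unfolding w(2) ye by (simp add: distrib_left q(2))
  also have "\<dots> = of_nat (Suc n) * (p * d) + p * s * (of_nat n * (r * d) + y * w + d * q)"
    unfolding ps unfolding y_def using 1 2 by (simp add: algebra_simps)
  finally have "y ^ Suc n * e - e * y ^ Suc n =
    of_nat (Suc n) * (p * d) + p * s * (of_nat n * (r * d) + y * w + d * q)" .
  moreover have "of_nat n * (r * d) + y * w + d * q \<in> R"
    using R r d(1) yR w(1) q(1) subring_of_nat[OF R] by (meson is_subringD)
  ultimately show ?case unfolding y_def by blast
qed

locale centrally_valued =
  fixes E V R :: "'a::division_ring set"
  assumes E: "division_subring E"
    and V: "valuation_subring (center_of E) V"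
    and R: "valuation_order E V R"
begin

abbreviation "F \<equiv> center_of E"

lemma F: "division_subring F" by (rule division_subring_center[OF E])
lemma Rr: "is_subring R" and RE: "R \<subseteq> E" and VR: "V \<subseteq> R"
  using R unfolding valuation_order_def by auto
lemma Vr: "is_subring V" and VF: "V \<subseteq> F" using V unfolding valuation_subring_def by auto
lemma FE: "F \<subseteq> E" unfolding center_of_def by auto
lemma F_comm: "f \<in> F \<Longrightarrow> x \<in> E \<Longrightarrow> f * x = x * f" using center_ofD(2) .

lemma primitive:
  assumes "d \<in> E" "d \<noteq> 0"
  obtains p where "p \<in> F" "p \<noteq> 0" "inverse p * d \<in> R"
    "\<And>u r. u \<in> F \<Longrightarrow> r \<in> R \<Longrightarrow> inverse u \<notin> V \<Longrightarrow> d \<noteq> p * u * r"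
  using R assms unfolding valuation_order_def by metis

text \<open>Minkowski's argument. Let \<open>d\<close> be the commutator of \<open>s * r\<close>
  with \<open>e\<close>, with content \<open>p\<close>. As the \<open>n\<close>-th power is central,
  its commutator with \<open>e\<close> vanishes, so \<open>of_nat n * d = - (p * s * w)\<close>.
  Thus the nonunit \<open>s / n\<close> would divide the primitive part of \<open>d\<close>.\<close>

lemma near_one_radical_central:
  assumes s: "s \<in> V" and r: "r \<in> R" and n: "of_nat n \<noteq> (0::'a)" "(1 + s * r) ^ n \<in> F"
    and small: "inverse (s * inverse (of_nat n)) \<notin> V"
  shows "1 + s * r \<in> F"
proof (rule ccontr)
  assume no: "1 + s * r \<notin> F"
  have sR: "s \<in> R" and sF: "s \<in> F" using s VR VF by auto
  have y: "1 + s * r \<in> E" using RE r sR Rr by (meson is_subringD subsetD)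
  then obtain e where e: "e \<in> E" "(1 + s * r) * e \<noteq> e * (1 + s * r)"
    using no unfolding center_of_def by auto
  define d where "d = s * r * e - e * (s * r)"
  have d0: "d \<noteq> 0" using e(2) unfolding d_def by (simp add: algebra_simps)
  have dE: "d \<in> E" unfolding d_def using RE r sR e E by (meson division_subringD subsetD)
  obtain p where p: "p \<in> F" "p \<noteq> 0" "inverse p * d \<in> R"
    "\<And>u r. u \<in> F \<Longrightarrow> r \<in> R \<Longrightarrow> inverse u \<notin> V \<Longrightarrow> d \<noteq> p * u * r" by (rule primitive[OF dE d0]) (rule that)
  have d_eq: "s * r * e - e * (s * r) = p * (inverse p * d)"
    using p(2) unfolding d_def by (simp flip: mult.assoc)
  obtain w where w: "w \<in> R"
    "(1 + s * r) ^ n * e - e * (1 + s * r) ^ n = of_nat n * (p * (inverse p * d)) + p * s * w"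
    using near_one_power_commutator[OF Rr sR _ r p(3) d_eq, of n] F_comm[OF sF] F_comm[OF p(1)] RE by blast
  moreover have "(1 + s * r) ^ n * e - e * (1 + s * r) ^ n = 0" using F_comm[OF n(2) e(1)] by simp
  moreover have "p * (inverse p * d) = d" using p(2) by (simp flip: mult.assoc)
  ultimately have "of_nat n * d = - (p * s * w)" by (simp add: eq_neg_iff_add_eq_0)
  then have "inverse (of_nat n) * (of_nat n * d) = - (inverse (of_nat n) * (p * s) * w)"
    by (simp add: mult.assoc)
  then have "d = - (inverse (of_nat n) * (p * s) * w)" using n(1) by (simp flip: mult.assoc)
  moreover have nF: "inverse (of_nat n) \<in> F"
    using subring_of_nat[OF division_subring_is_subring[OF F]] division_subring_inverse[OF F] by blast
  moreover have "inverse (of_nat n) * (p * s) = (p * s) * inverse (of_nat n)"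
    by (rule F_comm[OF nF], rule division_subringD(4)[OF E]) (use p sF FE in auto)
  ultimately have "d = p * (s * inverse (of_nat n)) * (- w)" by (simp add: mult.assoc)
  moreover have "s * inverse (of_nat n) \<in> F" using sF nF division_subringD(4)[OF F] by auto
  moreover have "- w \<in> R" using w is_subringD(5)[OF Rr] by auto
  ultimately show False using p(4) small by blast
qed

text \<open>Write the inverse as \<open>z = p * w\<close> with content \<open>p\<close>. If
  \<open>p\<close> is not in \<open>V\<close>, then \<open>z = p * (inverse p - s * w * r)\<close>,
  where \<open>inverse p\<close> and \<open>s\<close> are both nonunits; the one that divides the
  other divides the bracket, against primitivity.\<close>

lemma near_one_inverse:
  assumes s: "s \<in> V" "inverse s \<notin> V" and r: "r \<in> R"
  shows "inverse (1 + s * r) \<in> R"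
proof (cases "1 + s * r = 0")
  case True
  then show ?thesis using is_subringD(2)[OF Rr] by simp
next
  case False
  define z where "z = inverse (1 + s * r)"
  have z: "z \<noteq> 0" "z * (1 + s * r) = 1" using False unfolding z_def by auto
  have sR: "s \<in> R" and sF: "s \<in> F" using s VR VF by auto
  have s0: "s \<noteq> 0" using s is_subringD(2)[OF Vr] by auto
  have "1 + s * r \<in> E" using RE r sR Rr by (meson is_subringD subsetD)
  then have zE: "z \<in> E" unfolding z_def using division_subring_inverse[OF E] by blast
  obtain p where p: "p \<in> F" "p \<noteq> 0" "inverse p * z \<in> R"
    "\<And>u r. u \<in> F \<Longrightarrow> r \<in> R \<Longrightarrow> inverse u \<notin> V \<Longrightarrow> z \<noteq> p * u * r" by (rule primitive[OF zE z(1)]) (rule that)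
  define w where "w = inverse p * z"
  have zw: "z = p * w" and wR: "w \<in> R" using p unfolding w_def by (simp_all flip: mult.assoc)
  show ?thesis
  proof (cases "p \<in> V")
    case True
    then have "p * w \<in> R" using VR wR is_subringD(4)[OF Rr] by blast
    then show ?thesis using zw unfolding z_def by simp
  next
    case pV: False
    have ip: "inverse p \<in> F" using p division_subring_inverse[OF F] by blast
    have ws: "w * s = s * w" using F_comm[OF sF] wR RE by auto
    have "z = 1 - z * s * r" using z(2) by (simp add: algebra_simps)
    also have "\<dots> = p * (inverse p - s * w * r)"
      unfolding zw using p(2) ws by (simp add: right_diff_distrib mult.assoc)
    finally have z_eq: "z = p * (inverse p - s * w * r)" .
    \<comment> \<open>\<open>f\<close> is the quotient of \<open>s\<close> by
      \<open>inverse p\<close>; whether it or its inverse lies in \<open>V\<close> decides the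
      direction of divisibility.\<close>
    define f where "f = s * p"
    have fF: "f \<in> F" unfolding f_def using sF p division_subringD(4)[OF F] by blast
    have "f \<in> V \<or> inverse f \<in> V" using fF V unfolding valuation_subring_def by blast
    then show ?thesis
    proof
      assume fV: "f \<in> V"
      have "inverse p * f = s" unfolding f_def using p sF F_comm[OF sF] FE
        by (metis left_inverse mult.assoc mult.left_neutral subsetD)
      then have "z = p * inverse p * (1 - f * w * r)"
        unfolding z_eq by (simp add: right_diff_distrib mult.assoc) (metis mult.assoc)
      moreover have "1 - f * w * r \<in> R" using fV VR wR r Rr by (meson is_subringD subsetD)
      ultimately show ?thesis using p(4)[OF ip] pV p(2) by force
    next
      assume fV: "inverse f \<in> V"
      have "s * inverse f = inverse p"
        unfolding f_def using p(1,2) s0 F_comm[OF p(1), of s] sF FE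
        by (metis mult.assoc mult.left_neutral nonzero_inverse_mult_distrib right_inverse subsetD)
      then have "z = p * s * (inverse f - w * r)"
        unfolding z_eq by (simp add: right_diff_distrib mult.assoc)
      moreover have "inverse f - w * r \<in> R" using fV VR wR r Rr by (meson is_subringD subsetD)
      ultimately show ?thesis using p(4)[OF sF] s(2) by blast
    qed
  qed
qed

text \<open>The multiplier is the inverse of the content of \<open>a\<close> if that lies in
  \<open>V\<close>; otherwise the content is in \<open>V\<close> and \<open>a\<close> is already in
  \<open>R\<close>.\<close>

lemma scale_into_order:
  assumes "a \<in> E" obtains t where "t \<in> V" "t \<noteq> 0" "t * a \<in> R"
proof (cases "a = 0")
  case True
  then show thesis using that[of 1] is_subringD(1,2)[OF Vr] is_subringD(2)[OF Rr] by auto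
next
  case False
  obtain p where p: "p \<in> F" "p \<noteq> 0" "inverse p * a \<in> R"
    by (rule primitive[OF assms False])
  show thesis
  proof (cases "inverse p \<in> V")
    case True
    then show thesis using that[of "inverse p"] p by auto
  next
    case F: False
    then have "p \<in> V" using V p(1) unfolding valuation_subring_def by blast
    then have "p * (inverse p * a) \<in> R" using p(3) VR is_subringD(4)[OF Rr] by blast
    then have "a \<in> R" using p(2) by (simp flip: mult.assoc)
    then show thesis using that[of 1] is_subringD(1)[OF Vr] by auto
  qed
qed

end

definition normal_in :: "'a::division_ring set \<Rightarrow> 'a set \<Rightarrow> bool" where
  "normal_in E N \<longleftrightarrow> N \<subseteq> E - {0} \<and> (\<forall>x\<in>N. \<forall>y\<in>N. x * y \<in> N) \<and> (\<forall>x\<in>N. inverse x \<in> N) \<and>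
     (\<forall>d\<in>E. d \<noteq> 0 \<longrightarrow> (\<forall>x\<in>N. d * x * inverse d \<in> N))"

text \<open>For a noncentral \<open>x\<close> in \<open>N\<close>, the commutator of
  \<open>1 + q * a\<close> and \<open>x\<close> lies in \<open>N\<close> and is close to 1 for small
  central \<open>q\<close>, hence central. Two values of \<open>q\<close> give two linear relations
  between \<open>a\<close> and its conjugate \<open>a'\<close>, which force \<open>a = a'\<close> or
  \<open>a'\<close> central.\<close>

lemma (in centrally_valued) normal_central_if_near_one_central:
  assumes N: "normal_in E N" and s: "s \<in> V" "inverse s \<notin> V"
    and near: "\<And>r. r \<in> R \<Longrightarrow> 1 + s * r \<in> N \<Longrightarrow> 1 + s * r \<in> F"
  shows "N \<subseteq> F"
proof (rule subsetI, rule ccontr)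
  fix x assume x: "x \<in> N" "x \<notin> F"
  have xE: "x \<in> E" "x \<noteq> 0" using x N unfolding normal_in_def by auto
  then obtain a where a: "a \<in> E" "x * a \<noteq> a * x" using x unfolding center_of_def by auto
  define a' where "a' = x * a * inverse x"
  have a'E: "a' \<in> E" unfolding a'_def using a xE E by (meson division_subringD)
  have a_eq: "a' * x = x * a" unfolding a'_def using xE by (simp add: mult.assoc)
  have a'F: "a' \<notin> F"
  proof
    assume "a' \<in> F"
    then have "x * a' = x * a" using F_comm xE(1) a_eq by metis
    then have "a' = a" using xE(2) by simp
    then show False using a_eq a(2) by simp
  qed
  obtain t1 where t1: "t1 \<in> V" "t1 \<noteq> 0" "t1 * a \<in> R" by (rule scale_into_order[OF a(1)])
  obtain t2 where t2: "t2 \<in> V" "t2 \<noteq> 0" "t2 * a' \<in> R" by (rule scale_into_order[OF a'E])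
  define t where "t = t1 * t2"
  have t: "t \<in> V" "t \<noteq> 0" unfolding t_def using t1 t2 is_subringD(4)[OF Vr] by auto
  have tF: "t \<in> F" and sF: "s \<in> F" using t s VF by auto
  have s0: "s \<noteq> 0" using s is_subringD(2)[OF Vr] by auto
  have "t1 * t2 = t2 * t1" using t1 t2 VF FE F_comm by blast
  then have "t * a = t2 * (t1 * a)" "t * a' = t1 * (t2 * a')" unfolding t_def by (metis mult.assoc)+
  then have ta: "t * a \<in> R" and ta': "t * a' \<in> R" using t1 t2 VR is_subringD(4)[OF Rr] by auto
  have key: "\<exists>f\<in>F. 1 + s * (k * (t * a)) = f * (1 + s * (k * (t * a')))" if k: "k \<in> V" "k \<noteq> 0" for k
  proof -
    define g where "g = 1 + s * (k * (t * a))"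
    define g' where "g' = 1 + s * (k * (t * a'))"
    define q where "q = s * k * t"
    have q: "q \<in> F" "q \<noteq> 0" unfolding q_def using s0 k t sF tF VF division_subringD(4)[OF F] by auto
    have g_q: "g = 1 + q * a" "g' = 1 + q * a'" unfolding g_def g'_def q_def by (simp_all add: mult.assoc)
    have "q * x = x * q" using F_comm q xE by auto
    then have xg: "g' * x = x * g"
      unfolding g_q using a_eq by (simp add: algebra_simps) (metis mult.assoc)
    \<comment> \<open>Otherwise \<open>a'\<close> would equal \<open>- inverse q\<close>, which is
      central.\<close>
    have g'0: "g' \<noteq> 0"
    proof
      assume "g' = 0"
      then have "q * a' = - 1" unfolding g_q by (simp add: eq_neg_iff_add_eq_0 add.commute)
      then have "a' = inverse q * (- 1)" using q(2) by (metis left_inverse mult.assoc mult.left_neutral)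
      then have "a' \<in> F" using q F by (metis division_subringD(1,4,5,8))
      then show False using a'F by simp
    qed
    have g0: "g \<noteq> 0" using xg g'0 xE by (metis mult_eq_0_iff)
    have gE: "g \<in> E" unfolding g_def using k ta s VR RE Rr by (meson is_subringD subsetD)
    have ig': "inverse g' \<in> R"
      unfolding g'_def by (rule near_one_inverse[OF s]) (use k ta' VR is_subringD(4)[OF Rr] in auto)
    define y where "y = g * inverse g'"
    \<comment> \<open>This identifies \<open>g * inverse g'\<close> with the commutator of
      \<open>g\<close> and \<open>x\<close>, so that normality places it in
      \<open>N\<close>.\<close>
    have "inverse g' = x * inverse g * inverse x"
    proof (rule inverse_unique)
      have "g' * (x * inverse g * inverse x) = (g' * x) * inverse g * inverse x" by (simp add: mult.assoc)
      also have "\<dots> = x * (g * inverse g) * inverse x" unfolding xg by (simp add: mult.assoc)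
      finally show "g' * (x * inverse g * inverse x) = 1" using g0 xE by simp
    qed
    then have "y = (g * x * inverse g) * inverse x" unfolding y_def by (simp add: mult.assoc)
    then have yN: "y \<in> N" using N x(1) gE g0 unfolding normal_in_def by auto
    have "g = g' + s * (k * (t * a) - k * (t * a'))"
      unfolding g_def g'_def by (simp add: algebra_simps)
    then have "y = 1 + s * ((k * (t * a) - k * (t * a')) * inverse g')"
      unfolding y_def using g'0 by (simp add: distrib_right mult.assoc)
    moreover have "(k * (t * a) - k * (t * a')) * inverse g' \<in> R"
      using k ta ta' VR ig' Rr by (meson is_subringD subsetD)
    ultimately have "y \<in> F" using near yN by auto
    moreover have "g = y * g'" unfolding y_def using g'0 by (simp add: mult.assoc)
    ultimately show ?thesis unfolding g_def g'_def by blast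
  qed
  obtain f1 where f1: "f1 \<in> F" "1 + s * (1 * (t * a)) = f1 * (1 + s * (1 * (t * a')))"
    using key[of 1] is_subringD(1)[OF Vr] by auto
  obtain f2 where f2: "f2 \<in> F" "1 + s * (s * (t * a)) = f2 * (1 + s * (s * (t * a')))"
    using key[OF s(1) s0] by blast
  have sf1: "s * f1 = f1 * s" using F_comm[OF sF] f1(1) FE by auto
  have "s * (1 + s * (t * a)) = s * f1 * (1 + s * (t * a'))" using f1(2) by (simp add: mult.assoc)
  then have e1: "s + s * (s * (t * a)) = f1 * s + f1 * (s * (s * (t * a')))"
    unfolding sf1 by (simp add: distrib_left mult.assoc)
  have e2: "1 + s * (s * (t * a)) = f2 + f2 * (s * (s * (t * a')))" using f2(2) by (simp add: distrib_left)
  \<comment> \<open>Elimination of \<open>a\<close> between the relation for \<open>k = 1\<close>,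
    multiplied by \<open>s\<close>, and the relation for \<open>k = s\<close>.\<close>
  have e3: "s - 1 = f1 * s - f2 + (f1 - f2) * (s * (s * (t * a')))"
  proof -
    have "s - 1 = (s + s * (s * (t * a))) - (1 + s * (s * (t * a)))" by simp
    then show ?thesis unfolding e1 e2 by (simp add: algebra_simps)
  qed
  show False
  proof (cases "f1 = f2")
    case True
    then have "s - 1 = f1 * s - f1" using e3 by simp
    then have "1 * (s - 1) = f1 * (s - 1)" by (metis mult.right_neutral mult_1 right_diff_distrib)
    moreover have "s - 1 \<noteq> 0" using s is_subringD(1)[OF Vr] by auto
    ultimately have "f1 = 1" by (metis mult_right_cancel)
    then have "a = a'" using f1(2) s0 t(2) by simp
    then show False using a_eq a(2) by simp
  next
    case False
    define h where "h = (f1 - f2) * s * s * t"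
    have h: "h \<noteq> 0" "h \<in> F" unfolding h_def using False s0 t(2) f1 f2 sF tF
      by (auto intro!: division_subringD(4)[OF F] division_subringD(3)[OF F])
    have "h * a' = (s - 1) - (f1 * s - f2)" unfolding h_def using e3 by (simp add: mult.assoc)
    then have "h * a' \<in> F" using f1 f2 sF F by (metis division_subringD(1,3,4))
    moreover have "a' = inverse h * (h * a')" using h(1) by (simp flip: mult.assoc)
    ultimately have "a' \<in> F" using h(2) F by (metis division_subringD(4,8))
    then show False using a'F by simp
  qed
qed

section \<open>Normal subgroups that are radical over the center\<close>

lemma commuting_power_mult_distrib:
  fixes x y :: "'a::monoid_mult"
  assumes "x * y = y * x" shows "(x * y) ^ n = x ^ n * y ^ n"
proof (induction n)
  case (Suc n)
  have "(x * y) ^ Suc n = x * (y * x ^ n) * y ^ n" by (simp add: Suc mult.assoc)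
  also have "y * x ^ n = x ^ n * y" using power_commuting_commutes[OF assms, of n] by simp
  finally show ?case by (simp add: mult.assoc)
qed simp

lemma conj_power:
  fixes y :: "'a::division_ring"
  assumes "y \<noteq> 0" shows "(y * x * inverse y) ^ n = y * x ^ n * inverse y"
proof (induction n)
  case (Suc n)
  have "(y * x * inverse y) ^ Suc n = (y * x * inverse y) * (y * x ^ n * inverse y)"
    by (simp only: power_Suc Suc)
  also have "\<dots> = y * x * (inverse y * y) * x ^ n * inverse y" by (simp only: mult.assoc)
  finally have "(y * x * inverse y) ^ Suc n = y * x * (inverse y * y) * x ^ n * inverse y" .
  then show ?case using assms by (simp add: mult.assoc)
qed (use assms in simp)

text \<open>The binomial theorem for \<open>T = id + D\<close> among additive maps, with
  \<open>D x = T x - x\<close>; the induction step is Pascal's rule.\<close>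

lemma additive_power_newton:
  fixes T :: "'a::ring_1 \<Rightarrow> 'a"
  assumes add: "\<And>x y. T (x + y) = T x + T y"
  shows "(T ^^ n) d = (\<Sum>k\<le>n. of_nat (n choose k) * ((\<lambda>x. T x - x) ^^ k) d)"
proof (induction n)
  case (Suc n)
  define D where "D = (\<lambda>x. T x - x)"
  have T0: "T 0 = 0" using add[of 0 0] by simp
  have Tn: "T (of_nat m * x) = of_nat m * T x" for m x
    by (induction m) (auto simp: T0 add distrib_right)
  have Ts: "T (sum f A) = (\<Sum>k\<in>A. T (f k))" for f and A :: "nat set"
    by (induction A rule: infinite_finite_induct) (auto simp: T0 add)
  have TD: "T ((D ^^ k) d) = (D ^^ k) d + (D ^^ Suc k) d" for k unfolding D_def by simp
  have "(T ^^ Suc n) d = (\<Sum>k\<le>n. of_nat (n choose k) * T ((D ^^ k) d))"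
    using Suc by (simp add: Ts Tn D_def)
  also have "\<dots> = (\<Sum>k\<le>n. of_nat (n choose k) * (D ^^ k) d) + (\<Sum>k\<le>n. of_nat (n choose k) * (D ^^ Suc k) d)"
    unfolding TD distrib_left sum.distrib ..
  also have "(\<Sum>k\<le>n. of_nat (n choose k) * (D ^^ k) d)
      = (\<Sum>k\<le>Suc n. of_nat (n choose k) * (D ^^ k) d)" by (simp add: binomial_eq_0)
  also have "\<dots> = d + (\<Sum>k\<le>n. of_nat (n choose Suc k) * (D ^^ Suc k) d)"
    by (subst sum.atMost_Suc_shift) simp
  also have "d + (\<Sum>k\<le>n. of_nat (n choose Suc k) * (D ^^ Suc k) d) + (\<Sum>k\<le>n. of_nat (n choose k) * (D ^^ Suc k) d)
     = d + (\<Sum>k\<le>n. of_nat (Suc n choose Suc k) * (D ^^ Suc k) d)"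
    by (simp add: distrib_right sum.distrib add.assoc add.commute)
  also have "\<dots> = (\<Sum>k\<le>Suc n. of_nat (Suc n choose k) * (D ^^ k) d)"
    by (subst sum.atMost_Suc_shift[of _ n]) simp
  finally show ?case unfolding D_def .
qed simp

text \<open>The inner binomial coefficients are divisible by the characteristic. This is the
  Frobenius identity, stated for an additive map so that it applies to conjugations.\<close>

lemma additive_power_char:
  fixes T :: "'a::division_ring \<Rightarrow> 'a"
  assumes add: "\<And>x y. T (x + y) = T x + T y" and char: "CHAR('a) > 0"
  shows "(T ^^ CHAR('a)) d = d + ((\<lambda>x. T x - x) ^^ CHAR('a)) d"
proof -
  define p where "p = CHAR('a)"
  define g where "g k = of_nat (p choose k) * ((\<lambda>x. T x - x) ^^ k) d" for k
  have p: "prime p" unfolding p_def by (rule prime_CHAR[OF char])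
  have "g k = 0" if "0 < k" "k < p" for k
  proof -
    have "p dvd p choose k" using dvd_choose_prime[of k p] that p by auto
    then have "of_nat (p choose k) = (0::'a)" unfolding p_def by (simp add: of_nat_eq_0_iff_char_dvd)
    then show ?thesis unfolding g_def by simp
  qed
  then have "(\<Sum>k\<in>{..p} - {0, p}. g k) = 0" by (intro sum.neutral) auto
  moreover have "sum g {..p} = g 0 + g p + (\<Sum>k\<in>{..p} - {0, p}. g k)"
    using sum.subset_diff[of "{0, p}" "{..p}" g] char unfolding p_def by (simp add: add.commute)
  ultimately have "sum g {..p} = g 0 + g p" by simp
  then show ?thesis using additive_power_newton[OF add, of p d] unfolding g_def p_def by simp
qed

text \<open>With left multiplication by \<open>z\<close> as the additive map, the identity at 1
  reads \<open>z ^ p = 1 + (z - 1) ^ p\<close> for the characteristic \<open>p\<close>.\<close>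

lemma power_char_eq_1D:
  fixes z :: "'a::division_ring"
  assumes char: "CHAR('a) > 0" and z: "z ^ CHAR('a) = 1"
  shows "z = 1"
proof -
  have 1: "((*) z ^^ n) 1 = z ^ n" for n by (induction n) auto
  have 2: "((\<lambda>x. z * x - x) ^^ n) 1 = (z - 1) ^ n" for n
    by (induction n) (auto simp: left_diff_distrib)
  have "z ^ CHAR('a) = 1 + (z - 1) ^ CHAR('a)"
    using additive_power_char[of "(*) z" 1] char by (simp add: distrib_left 1 2)
  then have "(z - 1) ^ CHAR('a) = 0" using z by simp
  then show ?thesis by simp
qed

text \<open>Conjugation by \<open>y\<close> has order \<open>p\<close> in characteristic \<open>p\<close>, so conjugation minus the identity
  is nilpotent; the last two nonzero iterates at \<open>d\<close> have quotient \<open>e\<close>.\<close>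

lemma conj_shift_exists:
  fixes y :: "'a::division_ring"
  assumes E: "division_subring E" and char: "CHAR('a) > 0"
    and y: "y \<in> E" "y \<notin> center_of E" "y ^ CHAR('a) \<in> center_of E"
  obtains e where "e \<in> E" "y * e * inverse y = e + 1"
proof -
  have y0: "y \<noteq> 0" using y division_subringD(2)[OF division_subring_center[OF E]] by auto
  obtain d where d: "d \<in> E" "y * d \<noteq> d * y" using y unfolding center_of_def by auto
  define T where "T x = y * x * inverse y" for x
  define D where "D x = T x - x" for x
  have Tadd: "T (x + z) = T x + T z" for x z unfolding T_def by (simp add: algebra_simps)
  have TE: "T x \<in> E" if "x \<in> E" for x unfolding T_def using that y E by (meson division_subringD)
  have DE: "(D ^^ n) d \<in> E" for n
    by (induction n) (auto simp: D_def d TE intro: division_subringD(3)[OF E])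
  have Tn: "(T ^^ n) x = y ^ n * x * inverse (y ^ n)" for n x
  proof (induction n)
    case (Suc n)
    have "inverse (y ^ Suc n) = inverse (y ^ n) * inverse y"
      using y0 by (simp add: nonzero_inverse_mult_distrib)
    then show ?case using Suc by (simp add: T_def mult.assoc)
  qed simp
  \<comment> \<open>Since \<open>y ^ CHAR('a)\<close> is central, this iterate of \<open>T\<close>
    fixes \<open>d\<close>; by the Frobenius identity the same iterate of \<open>D\<close> kills
    \<open>d\<close>.\<close>
  have "(T ^^ CHAR('a)) d = d * y ^ CHAR('a) * inverse (y ^ CHAR('a))"
    unfolding Tn using center_ofD(2)[OF y(3) d(1)] by simp
  then have "(T ^^ CHAR('a)) d = d" using y0 by (simp add: mult.assoc)
  then have ex: "\<exists>n. (D ^^ n) d = 0"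
    using additive_power_char[of T d] Tadd char unfolding D_def by auto
  define m where "m = (LEAST n. (D ^^ n) d = 0)"
  have m: "(D ^^ m) d = 0" unfolding m_def using LeastI_ex[OF ex] .
  have less: "(D ^^ k) d \<noteq> 0" if "k < m" for k using that not_less_Least unfolding m_def by blast
  have "D d \<noteq> 0"
  proof
    assume "D d = 0"
    then have "y * d * inverse y * y = d * y" unfolding D_def T_def by simp
    then show False using d y0 by (simp add: mult.assoc)
  qed
  moreover from this have "d \<noteq> 0" unfolding D_def T_def by auto
  \<comment> \<open>At least two steps are needed to reach 0 because \<open>d\<close> does not
    commute with \<open>y\<close>.\<close>
  ultimately have "m \<noteq> 0" "m \<noteq> 1" using m by (auto intro: ccontr)
  then obtain k where k: "m = Suc (Suc k)" by (metis One_nat_def not0_implies_Suc)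
  define b where "b = (D ^^ k) d"
  define c where "c = D b"
  have c0: "c \<noteq> 0" using less[of "Suc k"] k unfolding c_def b_def by simp
  have Dc: "D c = 0" using m k unfolding c_def b_def by simp
  have Tb: "T b = b + c" and Tc: "T c = c" using Dc unfolding c_def D_def by auto
  have bE: "b \<in> E" unfolding b_def by (rule DE)
  have cE: "c \<in> E" unfolding c_def D_def using bE TE division_subringD(3)[OF E] by auto
  show thesis
  proof (rule that)
    show "b * inverse c \<in> E" using bE cE E by (meson division_subringD)
    have "y * (b * inverse c) * inverse y = T b * (y * inverse c * inverse y)"
      unfolding T_def using y0 by (simp add: mult.assoc flip: mult.assoc[of "inverse y" y])
    also have "y * inverse c * inverse y = inverse (T c)"
      unfolding T_def using y0 c0 by (simp add: nonzero_inverse_mult_distrib mult.assoc)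
    finally show "y * (b * inverse c) * inverse y = b * inverse c + 1"
      unfolding Tb Tc using c0 by (simp add: distrib_right)
  qed
qed

text \<open>With \<open>y e y\<inverse> = e + 1\<close> and \<open>h = e + s\<close>, the commutator \<open>z\<close> of \<open>h\<inverse>\<close> and \<open>y\<close>
  is \<open>h\<inverse> (h + 1)\<close>. Since \<open>z\<close> and \<open>y z y\<inverse>\<close> have a common central power, their quotient
  is torsion, so \<open>e + s\<close> is algebraic over the prime field for every central \<open>s\<close>.\<close>

lemma p_radical_central:
  fixes E :: "'a::division_ring set"
  assumes E: "division_subring E" and N: "normal_in E N" and rad: "radical_over N (center_of E)"
    and char: "CHAR('a) > 0" and t: "t \<in> center_of E" "t \<noteq> 0" "\<not> torsion t"
    and y: "y \<in> N" "y ^ CHAR('a) \<in> center_of E"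
  shows "y \<in> center_of E"
proof (rule ccontr)
  assume no: "y \<notin> center_of E"
  define F where "F = center_of E"
  have F: "division_subring F" unfolding F_def by (rule division_subring_center[OF E])
  have yE: "y \<in> E" "y \<noteq> 0" using y N unfolding normal_in_def by auto
  obtain e where e: "e \<in> E" "y * e * inverse y = e + 1"
    by (rule conj_shift_exists[OF E char yE(1) no y(2)])
  \<comment> \<open>Conjugation by \<open>y\<close> fixes central elements but shifts
    \<open>e\<close>; this keeps all the denominators below nonzero.\<close>
  have eF: "e + f \<noteq> 0" if "f \<in> F" for f
  proof
    assume "e + f = 0"
    then have "e = - f" by (simp add: eq_neg_iff_add_eq_0)
    then have "e \<in> F" using that division_subringD(5)[OF F] by simp
    then have "y * e * inverse y = e" using yE center_ofD(2)[of e E y] unfolding F_def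
      by (metis mult.assoc mult.right_neutral right_inverse)
    then show False using e(2) by simp
  qed
  have tors: "torsion (e + s + 1)" if s: "s \<in> F" for s
  proof -
    define h where "h = e + s"
    have sy: "y * s = s * y" using center_ofD(2)[of s E y] s yE unfolding F_def by simp
    have s1: "s + 1 \<in> F" "s + 2 \<in> F" using s F division_subringD(1,6)[OF F] by (auto simp flip: one_add_one)
    have nz: "h \<noteq> 0" "h + 1 \<noteq> 0" "h + 2 \<noteq> 0"
      unfolding h_def using eF[OF s] eF[OF s1(1)] eF[OF s1(2)] by (simp_all add: add.assoc)
    have hE: "h \<in> E" unfolding h_def using e s center_ofD(1) division_subringD(6)[OF E] unfolding F_def by blast
    have "y * s * inverse y = s" unfolding sy using yE by (simp add: mult.assoc)
    then have yh: "y * h * inverse y = h + 1" unfolding h_def using e(2)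
      by (simp add: distrib_left distrib_right)
    define z where "z = inverse h * (h + 1)"
    have "inverse h * y * inverse (inverse h) * inverse y \<in> N"
      using N y(1) division_subring_inverse[OF E hE] nz unfolding normal_in_def by auto
    moreover have "inverse h * y * inverse (inverse h) * inverse y = z"
      unfolding z_def yh[symmetric] using nz by (simp add: mult.assoc)
    ultimately have zN: "z \<in> N" by simp
    then obtain n where n: "n > 0" "z ^ n \<in> F" using rad unfolding radical_over_def F_def by auto
    define z' where "z' = y * z * inverse y"
    have conj_inv: "inverse (y * x * inverse y) = y * inverse x * inverse y" if "x \<noteq> 0" for x
      using that yE by (simp add: nonzero_inverse_mult_distrib mult.assoc)
    have yh1: "y * (h + 1) * inverse y = h + 2"
      using yh yE by (simp add: distrib_left distrib_right add.assoc)
    have "z' = (y * inverse h * inverse y) * (y * (h + 1) * inverse y)"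
      unfolding z'_def z_def using yE by (simp add: mult.assoc flip: mult.assoc[of "inverse y" y])
    then have z': "z' = inverse (h + 1) * (h + 2)" using conj_inv[OF nz(1)] yh yh1 by simp
    have "z' ^ n = y * z ^ n * inverse y" unfolding z'_def by (rule conj_power[OF yE(2)])
    also have "\<dots> = z ^ n * y * inverse y" using center_ofD(2)[of "z ^ n" E y] n(2) yE(1) unfolding F_def by simp
    finally have zz: "z' ^ n = z ^ n" using yE by (simp add: mult.assoc)
    \<comment> \<open>The centralizer \<open>C\<close> of \<open>h\<close> and its centralizer
      \<open>B\<close> commute elementwise, and both contain \<open>h\<close> and its rational
      expressions; this supplies the commutations below.\<close>
    define C where "C = {x. \<forall>u\<in>{h}. u * x = x * u}"
    have C: "division_subring C" unfolding C_def by (rule division_subring_centralizer)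
    define g where "g = h + 1"
    define w where "w = z * inverse z'"
    have z'0: "z' \<noteq> 0" unfolding z' using nz by simp
    have z0: "z \<noteq> 0" unfolding z_def using nz by simp
    define B where "B = {x. \<forall>u\<in>C. u * x = x * u}"
    have B: "division_subring B" unfolding B_def by (rule division_subring_centralizer)
    have hB: "h \<in> B" unfolding B_def C_def by auto
    have hC: "h \<in> C" unfolding C_def by auto
    have Bc: "a * b = b * a" if "a \<in> C" "b \<in> B" for a b using that unfolding B_def by auto
    have h1: "h + 1 \<in> B" "h + 2 \<in> B" "h + 1 \<in> C" "h + 2 \<in> C"
      using hB hC division_subringD(1,6)[OF B] division_subringD(1,6)[OF C]
      by (auto simp: add.assoc simp flip: one_add_one)
    have zB: "z \<in> B" "z' \<in> B" "z \<in> C" "z' \<in> C" unfolding z_def z' using hB hC h1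
      by (auto intro!: division_subringD(4)[OF B] division_subringD(4)[OF C]
          division_subring_inverse[OF B] division_subring_inverse[OF C])
    have "w ^ n = z ^ n * inverse z' ^ n"
      unfolding w_def
      by (rule commuting_power_mult_distrib, rule Bc) (use zB division_subring_inverse[OF B] in auto)
    also have "\<dots> = 1" using zz z0 by (simp add: power_inverse)
    finally have w1: "torsion w" unfolding torsion_def using n(1) by blast
    have "inverse z' = inverse (h + 2) * (h + 1)"
      unfolding z' using nz by (simp add: nonzero_inverse_mult_distrib)
    then have "w = inverse h * (h + 1) * (inverse (h + 2) * (h + 1))" unfolding w_def z_def by simp
    also have "\<dots> = (h + 1) * (h + 1) * (inverse h * inverse (h + 2))"
    proof -
      have i: "inverse h \<in> C" "inverse (h + 2) \<in> C"
        using hC h1 division_subring_inverse[OF C] by auto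
      have 1: "inverse h * (h + 1) = (h + 1) * inverse h" by (rule Bc[OF i(1) h1(1)])
      have 2: "inverse h * inverse (h + 2) * (h + 1) = (h + 1) * (inverse h * inverse (h + 2))"
        by (rule Bc[OF division_subringD(4)[OF C i] h1(1)])
      show ?thesis using 1 2 by (metis mult.assoc)
    qed
    also have "inverse h * inverse (h + 2) = inverse ((h + 2) * h)"
      using nz by (simp add: nonzero_inverse_mult_distrib)
    also have hh: "(h + 2) * h = g ^ 2 - 1"
      unfolding g_def power2_eq_square by (simp add: algebra_simps mult_2 mult_2_right)
    finally have w_eq: "w = g ^ 2 * inverse (g ^ 2 - 1)" unfolding g_def power2_eq_square .
    have nz': "g ^ 2 - 1 \<noteq> 0" unfolding hh[symmetric] using nz by simp
    have w2: "w * (g ^ 2 - 1) = g ^ 2" unfolding w_eq using nz' by (simp add: mult.assoc)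
    \<comment> \<open>Solving \<open>w = g^2 / (g^2 - 1)\<close> for \<open>g^2\<close> places it in
      a finite ring containing the torsion element \<open>w\<close>.\<close>
    then have "(w - 1) * g ^ 2 = w" by (simp add: algebra_simps)
    moreover have "w - 1 \<noteq> 0" using w2 by auto
    ultimately have g2: "g ^ 2 = inverse (w - 1) * w" by (metis left_inverse mult.assoc mult.left_neutral)
    have "\<exists>A. finite A \<and> is_subring A \<and> {w} \<subseteq> A \<and> (\<forall>B. is_subring B \<longrightarrow> {w} \<subseteq> B \<longrightarrow> A \<subseteq> B)"
      by (rule finite_subring_of_torsion[OF char]) (use w1 in auto)
    then obtain A where A: "finite A" "is_subring A" "w \<in> A" by blast
    have "g ^ 2 \<in> A" unfolding g2 using A
      by (intro is_subringD(4)[OF A(2)] finite_subring_inverse is_subringD(3)[OF A(2)] is_subringD(1)[OF A(2)])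
    then have "torsion (g ^ 2)" using finite_subring_torsion[OF A(1,2)] nz unfolding g_def by simp
    then show ?thesis using torsion_powerD[of g 2] unfolding g_def h_def by simp
  qed
  \<comment> \<open>The choices \<open>s = 0\<close> and \<open>s = t\<close> give two commuting
    torsion elements with difference \<open>t\<close>, so \<open>t\<close> would lie in a finite
    subring.\<close>
  have tE: "t * e = e * t" using center_ofD(2)[OF t(1) e(1)] .
  have t1: "torsion (e + 1)" "torsion (e + t + 1)"
    using tors[of 0] tors[of t] t(1) division_subringD(2)[OF F] unfolding F_def by auto
  have "\<exists>A. finite A \<and> is_subring A \<and> {e + 1, e + t + 1} \<subseteq> A \<and>
      (\<forall>B. is_subring B \<longrightarrow> {e + 1, e + t + 1} \<subseteq> B \<longrightarrow> A \<subseteq> B)"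
    by (rule finite_subring_of_torsion[OF char]) (use t1 tE in \<open>auto simp: algebra_simps\<close>)
  then obtain A where A: "finite A" "is_subring A" "e + 1 \<in> A" "e + t + 1 \<in> A" by blast
  have "(e + t + 1) - (e + 1) \<in> A" using A is_subringD(3) by blast
  then have "t \<in> A" by (simp add: algebra_simps)
  then show False using finite_subring_torsion[OF A(1,2)] t(2,3) by blast
qed

section \<open>The cases with a nontrivial valuation of the center\<close>

text \<open>The valuation ring has 2 as a nonunit, and elements congruent to 1 modulo 4 are
  considered. Modulo 2 would not do: for the exponent 2 the quotient \<open>s / n\<close> must be a
  nonunit, and \<open>4 / 2\<close> is one while \<open>2 / 2\<close> is not.\<close>

lemma normal_radical_central_char_0:
  fixes E :: "'a::division_ring set"
  assumes E: "division_subring E" "fin_dim_over_center E" and N: "normal_in E N"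
    and rad: "radical_over N (center_of E)" and char: "CHAR('a) = 0"
  shows "N \<subseteq> center_of E"
proof -
  define F where "F = center_of E"
  have F: "division_subring F" unfolding F_def by (rule division_subring_center[OF E(1)])
  have nat0: "of_nat n \<noteq> (0::'a)" if "n > 0" for n using char that by (simp add: CHAR_eq0_iff)
  have two: "2 \<noteq> (0::'a)" using nat0[of 2] by simp
  \<comment> \<open>If one half were the image of an integer \<open>k\<close>, the nonzero integer
    \<open>2 * k - 1\<close> would vanish in characteristic 0.\<close>
  have "inverse 2 \<notin> adjoin \<int> (2::'a)"
  proof
    assume "inverse 2 \<in> adjoin \<int> (2::'a)"
    moreover have "adjoin \<int> (2::'a) \<subseteq> \<int>" by (rule adjoin_least[OF is_subring_Ints]) auto
    ultimately obtain k where k: "inverse (2::'a) = of_int k" by (meson Ints_cases subsetD)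
    have "inverse (2::'a) * 2 = 1" using two by (rule left_inverse)
    then have z: "of_int (k * 2 - 1) = (0::'a)" unfolding k by simp
    obtain n where n: "k * 2 - 1 = int n \<or> k * 2 - 1 = - int n" by (metis int_cases2)
    then have "n > 0" by presburger
    moreover have "of_nat n = (0::'a)" 
      using n z by (metis neg_equal_0_iff_equal of_int_minus of_int_of_nat_eq)
    ultimately show False using nat0 by blast
  qed
  moreover have "2 \<in> F" using subring_of_nat[OF division_subring_is_subring[OF F], of 2] by simp
  ultimately obtain V where V: "valuation_subring F V" "2 \<in> V" "inverse 2 \<notin> V"
    using valuation_subring_exists[OF F, of 2] two center_ofD unfolding F_def by metis
  obtain R where R: "valuation_order E V R"
    using valuation_order_exists[OF E V(1)[unfolded F_def]] unfolding valuation_order_def by metis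
  interpret cv: centrally_valued E V R
    by standard (use E V R in \<open>auto simp: F_def\<close>)
  have V4: "4 \<in> V" using is_subringD(4)[OF cv.Vr V(2) V(2)] by simp
  have i4: "inverse 4 * 2 = inverse (2::'a)"
  proof -
    have "inverse (4::'a) = inverse (2 * 2)" by simp
    also have "\<dots> = inverse 2 * inverse 2" using two nonzero_inverse_mult_distrib by blast
    finally show ?thesis using two by (simp add: mult.assoc)
  qed
  have iV4: "inverse 4 \<notin> V" using V(2,3) is_subringD(4)[OF cv.Vr, of "inverse 4" 2] i4 by metis
  \<comment> \<open>Induction on the exponent: an even one is halved, because the
    \<open>j\<close>-th power is again close to 1 and has a central square.\<close>
  have central: "1 + 4 * r \<in> F" if "n > 0" "r \<in> R" "(1 + 4 * r) ^ n \<in> F" for n r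
    using that
  proof (induction n arbitrary: r rule: less_induct)
    case (less n)
    show ?case
    proof (cases "even n")
      case True
      then obtain j where j: "n = j * 2" by (auto elim: evenE)
      obtain q where q: "q \<in> R" "(1 + 4 * r) ^ j = 1 + 4 * q"
        using near_one_power[OF cv.Rr, of 4 r j] less.prems V4 cv.VR cv.F_comm[of 4] cv.VF cv.RE by blast
      have "(1 + 4 * q) ^ 2 \<in> F" using less.prems(3) unfolding j power_mult q(2) .
      moreover have "4 * inverse (of_nat 2) = (2::'a)"
      proof -
        have "4 * inverse 2 = 2 * (2 * inverse (2::'a))" by (simp flip: mult.assoc)
        then show ?thesis by (simp only: of_nat_numeral right_inverse[OF two] mult_1_right)
      qed
      then have "inverse (4 * inverse (of_nat 2)) \<notin> V" using V(3) by (simp only: not_False_eq_True)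
      ultimately have "1 + 4 * q \<in> F"
        using cv.near_one_radical_central[OF V4 q(1), of 2] nat0[OF zero_less_numeral] unfolding F_def by blast
      then show ?thesis using less.IH[of j r] less.prems j q(2) by simp
    next
      case False
      then obtain j where j: "n = 2 * j + 1" by (auto elim: oddE)
      \<comment> \<open>If \<open>n / 4\<close> were in \<open>V\<close>, so would be
        \<open>n / 2 = j + 1 / 2\<close>, and hence one half.\<close>
      have "inverse (4 * inverse (of_nat n)) \<notin> V"
      proof
        assume *: "inverse (4 * inverse (of_nat n)) \<in> V"
        have "inverse (4 * inverse (of_nat n)) = of_nat n * inverse (4::'a)"
          using nat0[OF less.prems(1)] nat0[of 4] by (simp add: nonzero_inverse_mult_distrib)
        then have "of_nat n * inverse 4 * 2 \<in> V" using * V(2) is_subringD(4)[OF cv.Vr] by metis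
        then have "of_nat n * inverse 2 \<in> V" by (metis mult.assoc i4)
        moreover have "of_nat n = of_nat j * 2 + (1::'a)" unfolding j by (simp add: mult_2 mult_2_right)
        then have "of_nat n * inverse 2 = of_nat j + inverse (2::'a)"
          by (simp only: distrib_right mult.assoc right_inverse[OF two] mult_1_right mult_1_left)
        ultimately have "of_nat j + inverse 2 - of_nat j \<in> V"
          using subring_of_nat[OF cv.Vr] is_subringD(3)[OF cv.Vr] by metis
        then show False using V(3) by simp
      qed
      then show ?thesis
        using cv.near_one_radical_central[OF V4 less.prems(2) nat0[OF less.prems(1)]] less.prems(3)
        unfolding F_def by blast
    qed
  qed
  show ?thesis
  proof (rule cv.normal_central_if_near_one_central[OF N V4 iV4])
    fix r assume "r \<in> R" "1 + 4 * r \<in> N"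
    then show "1 + 4 * r \<in> center_of E" using central rad unfolding radical_over_def F_def by blast
  qed
qed

text \<open>A factor \<open>p\<close> of the exponent is removed by
  \<open>p_radical_central\<close>; an exponent prime to \<open>p\<close> is a unit of the prime
  field, so \<open>t / n\<close> is a nonunit along with \<open>t\<close>.\<close>

lemma normal_radical_central_char_p:
  fixes E :: "'a::division_ring set"
  assumes E: "division_subring E" "fin_dim_over_center E" and N: "normal_in E N"
    and rad: "radical_over N (center_of E)" and char: "CHAR('a) > 0"
    and t: "t \<in> center_of E" "t \<noteq> 0" "\<not> torsion t"
  shows "N \<subseteq> center_of E"
proof -
  define F where "F = center_of E"
  have F: "division_subring F" unfolding F_def by (rule division_subring_center[OF E(1)])
  have "inverse t \<notin> adjoin \<int> t" using inverse_in_adjoin_Ints_torsion[OF char t(2)] t(3) by blast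
  then obtain V where V: "valuation_subring F V" "t \<in> V" "inverse t \<notin> V"
    using valuation_subring_exists[OF F, of t] t center_ofD unfolding F_def by metis
  obtain R where R: "valuation_order E V R"
    using valuation_order_exists[OF E V(1)[unfolded F_def]] unfolding valuation_order_def by metis
  interpret cv: centrally_valued E V R
    by standard (use E V R in \<open>auto simp: F_def\<close>)
  \<comment> \<open>\<open>p_radical_central\<close> will be applied to powers of a member of
    \<open>N\<close>.\<close>
  have Np: "x ^ k \<in> N" if "x \<in> N" for x k
  proof -
    have "1 \<in> N" using N that unfolding normal_in_def by (metis DiffE left_inverse singletonI subsetD)
    then show ?thesis using N that unfolding normal_in_def by (induction k) auto
  qed
  have central: "1 + t * r \<in> F" if "n > 0" "r \<in> R" "1 + t * r \<in> N" "(1 + t * r) ^ n \<in> F" for n r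
    using that
  proof (induction n arbitrary: r rule: less_induct)
    case (less n)
    show ?case
    proof (cases "CHAR('a) dvd n")
      case True
      then obtain j where j: "n = j * CHAR('a)" by (metis dvdE mult.commute)
      have "((1 + t * r) ^ j) ^ CHAR('a) \<in> F" using less.prems(4) unfolding j power_mult .
      then have "(1 + t * r) ^ j \<in> F"
        using p_radical_central[OF E(1) N rad char t Np[OF less.prems(3)]] unfolding F_def by blast
      moreover have "j < n" "j > 0" using j less.prems(1) prime_gt_1_nat[OF prime_CHAR[OF char]] by auto
      ultimately show ?thesis using less.IH less.prems by blast
    next
      case False
      have n0: "of_nat n \<noteq> (0::'a)" using False by (simp add: of_nat_eq_0_iff_char_dvd)
      have "coprime CHAR('a) n" using False prime_CHAR[OF char] by (simp add: prime_imp_coprime)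
      then have "gcd n CHAR('a) = 1" by (simp add: coprime_iff_gcd_eq_1 gcd.commute)
      \<comment> \<open>Bezout provides a natural number inverse to \<open>n\<close> in the prime
        field, so multiplication by it does not leave \<open>V\<close>.\<close>
      then obtain x y where xy: "n * x = CHAR('a) * y + 1" 
        using bezout_nat[of n "CHAR('a)"] less.prems(1) by (metis neq0_conv)
      have "of_nat n * of_nat x = of_nat CHAR('a) * of_nat y + (1::'a)"
        using arg_cong[OF xy, of "of_nat :: nat \<Rightarrow> 'a"] by (simp only: of_nat_mult of_nat_add of_nat_1)
      then have nx: "of_nat x * of_nat n = (1::'a)"
        by (metis add_0 mult_of_nat_commute mult_zero_left of_nat_CHAR)
      have "inverse (t * inverse (of_nat n)) \<notin> V"
      proof
        assume *: "inverse (t * inverse (of_nat n)) \<in> V"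
        have "inverse (t * inverse (of_nat n)) = of_nat n * inverse t"
          using n0 t(2) by (simp add: nonzero_inverse_mult_distrib)
        then have "of_nat x * (of_nat n * inverse t) \<in> V"
          using * is_subringD(4)[OF cv.Vr subring_of_nat[OF cv.Vr]] by metis
        then show False using V(3) nx by (metis mult.assoc mult.left_neutral)
      qed
      then show ?thesis
        using cv.near_one_radical_central[OF V(2) less.prems(2) n0] less.prems(4) unfolding F_def by blast
    qed
  qed
  show ?thesis
  proof (rule cv.normal_central_if_near_one_central[OF N V(2,3)])
    fix r assume "r \<in> R" "1 + t * r \<in> N"
    then show "1 + t * r \<in> center_of E" using central rad unfolding radical_over_def F_def by blast
  qed
qed

section \<open>Algebras over a center of torsion elements\<close>

text \<open>Discrete Fourier transform of the orbit of \<open>d\<close> under conjugation by \<open>x\<close>: the powers of \<open>x\<close>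
  supply all the roots of unity that are needed.\<close>

lemma torsion_normalizer:
  fixes x :: "'a::division_ring"
  assumes E: "division_subring E" and x: "x \<in> E" "x \<notin> center_of E" "torsion x" and char: "CHAR('a) > 0"
  obtains v k where "v \<in> E" "v \<noteq> 0" "v * x = x ^ k * v" "v * x \<noteq> x * v"
proof -
  define n where "n = (LEAST n. n > 0 \<and> x ^ n = 1)"
  have "n > 0 \<and> x ^ n = 1" unfolding n_def by (rule LeastI_ex) (use x(3) in \<open>auto simp: torsion_def\<close>)
  then have n: "n > 0" "x ^ n = 1" by auto
  have least: "x ^ k \<noteq> 1" if "0 < k" "k < n" for k
    using not_less_Least[of k "\<lambda>n. n > 0 \<and> x ^ n = 1"] that unfolding n_def by auto
  have x0: "x \<noteq> 0" by (rule torsion_nonzero[OF x(3)])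
  \<comment> \<open>The order of \<open>x\<close> is prime to the characteristic \<open>p\<close>,
    since 1 is the only \<open>p\<close>-th root of 1; dividing by \<open>n\<close> is what inverts
    the transform.\<close>
  have n0: "of_nat n \<noteq> (0::'a)"
  proof
    assume "of_nat n = (0::'a)"
    then obtain m where m: "n = m * CHAR('a)" by (metis dvdE mult.commute of_nat_eq_0_iff_char_dvd)
    have "(x ^ m) ^ CHAR('a) = 1" using n(2) unfolding m power_mult .
    then have "x ^ m = 1" by (rule power_char_eq_1D[OF char])
    moreover have "0 < m" "m < n" using m n(1) prime_gt_1_nat[OF prime_CHAR[OF char]] by auto
    ultimately show False using least by blast
  qed
  obtain d where d: "d \<in> E" "x * d \<noteq> d * x" using x unfolding center_of_def by auto
  define y where "y = inverse x"
  have xy: "x * y = 1" "y * x = 1" unfolding y_def using x0 by auto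
  have yn: "y ^ n = 1" unfolding y_def using n by (simp add: power_inverse)
  define v where "v i = (\<Sum>j<n. y ^ (i * j) * (x ^ j * d * y ^ j))" for i
  have xyp: "x * y ^ k = y ^ k * x" for k
    using power_commuting_commutes[of y x k] xy by simp
  \<comment> \<open>Conjugation by \<open>x\<close> shifts the sum cyclically, so \<open>v i\<close>
    is an eigenvector with \<open>x ^ i\<close> as left eigenvalue.\<close>
  have xv: "y ^ i * (x * v i * y) = v i" for i
  proof -
    define g where "g j = y ^ (i * j) * (x ^ j * d * y ^ j)" for j
    have "y ^ i * (x * v i * y) = (\<Sum>j<n. y ^ i * (x * g j * y))"
      unfolding v_def g_def by (simp add: sum_distrib_left sum_distrib_right)
    also have "\<dots> = (\<Sum>j<n. g (Suc j))"
    proof (rule sum.cong[OF refl])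
      fix j
      have "y ^ i * (x * g j * y) = y ^ i * ((x * y ^ (i * j)) * (x ^ j * d * y ^ j) * y)"
        unfolding g_def by (simp only: mult.assoc)
      also have "\<dots> = y ^ i * y ^ (i * j) * (x * x ^ j) * d * (y ^ j * y)"
        unfolding xyp by (simp only: mult.assoc)
      also have "\<dots> = y ^ (i * Suc j) * (x ^ Suc j * d * y ^ Suc j)"
        by (simp only: power_add mult_Suc_right power_Suc2[of y j] power_Suc[of x j] mult.assoc)
      also have "\<dots> = g (Suc j)" unfolding g_def ..
      finally show "y ^ i * (x * g j * y) = g (Suc j)" .
    qed
    also have "\<dots> = (\<Sum>j<n. g j)"
    proof -
      have "g n = g 0" unfolding g_def using n yn by (simp add: power_mult mult.commute[of i n])
      moreover have "(\<Sum>j<n. g (Suc j)) + g 0 = (\<Sum>j<n. g j) + g n"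
        using sum.lessThan_Suc_shift[of g n] by (simp add: add.commute)
      ultimately show ?thesis by simp
    qed
    finally show ?thesis unfolding v_def g_def .
  qed
  have vE: "v i \<in> E" for i
    unfolding v_def y_def
    by (intro subring_sum[OF division_subring_is_subring[OF E]] division_subringD(4)[OF E]
        division_subringD(7)[OF E] division_subring_inverse[OF E] x(1) d(1))
  have vx: "x * v i = x ^ i * v i * x" for i
  proof -
    have "x ^ i * y ^ i = 1" unfolding y_def using x0 by (simp add: power_inverse)
    then have "x ^ i * (y ^ i * (x * v i * y)) = x * v i * y" by (metis mult.assoc mult.left_neutral)
    then have "x ^ i * v i = x * v i * y" unfolding xv by simp
    then have "x ^ i * v i * x = x * v i * (y * x)" by (simp add: mult.assoc)
    then show ?thesis using xy by simp
  qed
  \<comment> \<open>Orthogonality of roots of unity makes the \<open>v i\<close> sum to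
    \<open>n * d\<close>. If only \<open>v 0\<close> survived, which commutes with \<open>x\<close>,
    then \<open>d\<close> would commute with \<open>x\<close>.\<close>
  have "\<exists>i. 0 < i \<and> i < n \<and> v i \<noteq> 0"
  proof (rule ccontr)
    assume "\<not> ?thesis"
    then have v0: "v i = 0" if "0 < i" "i < n" for i using that by auto
    have "(\<Sum>i<n. v i) = v 0 + (\<Sum>i\<in>{..<n} - {0}. v i)" using n(1) by (subst sum.remove[of _ 0]) auto
    also have "(\<Sum>i\<in>{..<n} - {0}. v i) = 0" by (rule sum.neutral) (use v0 in auto)
    finally have 1: "(\<Sum>i<n. v i) = v 0" by simp
    have "(\<Sum>i<n. v i) = (\<Sum>j<n. (\<Sum>i<n. (y ^ j) ^ i) * (x ^ j * d * y ^ j))"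
      unfolding v_def by (subst sum.swap) (simp add: sum_distrib_right power_mult mult.commute flip: power_mult)
    also have "\<dots> = (\<Sum>j<n. if j = 0 then of_nat n * d else 0)"
    proof (rule sum.cong[OF refl])
      fix j assume j: "j \<in> {..<n}"
      show "(\<Sum>i<n. (y ^ j) ^ i) * (x ^ j * d * y ^ j) = (if j = 0 then of_nat n * d else 0)"
      proof (cases "j = 0")
        case False
        have "(y ^ j - 1) * (\<Sum>i<n. (y ^ j) ^ i) = (y ^ j) ^ n - 1"
          by (induction n) (auto simp: algebra_simps)
        also have "\<dots> = 0" using yn by (metis diff_self mult.commute power_mult power_one)
        finally have "y ^ j - 1 = 0 \<or> (\<Sum>i<n. (y ^ j) ^ i) = 0" by simp
        moreover have "y ^ j \<noteq> 1" unfolding y_def using least[of j] j False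
          by (metis gr0I inverse_1 inverse_inverse_eq lessThan_iff power_inverse)
        ultimately show ?thesis using False by simp
      qed simp
    qed
    also have "\<dots> = of_nat n * d" using n(1) by (simp add: sum.delta)
    finally have "of_nat n * d = v 0" using 1 by simp
    moreover have "x * v 0 = v 0 * x" using vx[of 0] by simp
    ultimately have "x * (of_nat n * d) = of_nat n * d * x" by simp
    moreover have "x * (of_nat n * d) = of_nat n * (x * d)" by (metis mult.assoc mult_of_nat_commute)
    ultimately have "of_nat n * (x * d) = of_nat n * (d * x)" by (simp add: mult.assoc)
    then show False using n0 d(2) by simp
  qed
  then obtain i where i: "0 < i" "i < n" "v i \<noteq> 0" by blast
  define w where "w = v i"
  have w: "x * w = x ^ i * w * x" "w \<noteq> 0" "w \<in> E" using vx i(3) vE unfolding w_def by auto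
  \<comment> \<open>\<open>x ^ (n - i)\<close> inverts \<open>x ^ i\<close> and solves the
    eigenvector equation for \<open>w * x\<close>.\<close>
  have "x ^ (n - i) * x ^ i = 1" using i(2) n(2) by (simp flip: power_add)
  then have "w * x = x ^ (n - i) * (x * w)" unfolding w(1) by (metis mult.assoc mult.left_neutral)
  then have wx: "w * x = x ^ (n - i + 1) * w" by (simp only: power_add power_one_right mult.assoc)
  have "w * x \<noteq> x * w"
  proof
    assume "w * x = x * w"
    then have "1 * (w * x) = x ^ i * (w * x)" using w(1) by (simp add: mult.assoc)
    moreover have "w * x \<noteq> 0" using w(2) x0 by simp
    ultimately have "x ^ i = 1" by (metis mult_right_cancel)
    then show False using least i by blast
  qed
  then show thesis using that w wx by blast
qed

section \<open>Independence of semilinear maps and surjectivity of the norm\<close>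

lemma card_fibres_le:
  assumes "finite A" "\<And>b. b \<in> f ` A \<Longrightarrow> card {a\<in>A. f a = b} \<le> k"
  shows "card A \<le> k * card (f ` A)"
proof -
  have "card A = (\<Sum>b\<in>f ` A. card {a\<in>A. f a = b})"
    using sum.image_gen[OF assms(1), of "\<lambda>_. 1::nat" f] by simp
  also have "\<dots> \<le> (\<Sum>b\<in>f ` A. k)" by (rule sum_mono) (rule assms(2))
  finally show ?thesis by (simp add: mult.commute)
qed

lemma card_fibres_ge:
  assumes "finite A" "\<And>b. b \<in> f ` A \<Longrightarrow> k \<le> card {a\<in>A. f a = b}"
  shows "k * card (f ` A) \<le> card A"
proof -
  have "k * card (f ` A) = (\<Sum>b\<in>f ` A. k)" by simp
  also have "\<dots> \<le> (\<Sum>b\<in>f ` A. card {a\<in>A. f a = b})" by (rule sum_mono) (rule assms(2))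
  also have "\<dots> = card A"
    using sum.image_gen[OF assms(1), of "\<lambda>_. 1::nat" f] by simp
  finally show ?thesis .
qed

text \<open>Dedekind's argument: evaluate the relation at \<open>x * z\<close> and subtract
  \<open>y k\<close> times the relation at \<open>z\<close>; the \<open>k\<close>-th term cancels
  and the others acquire the nonzero factors \<open>y j - y k\<close>. The maps are conjugations in
  one application and left multiplications in the other.\<close>

lemma semilinear_independent:
  fixes A :: "'a::division_ring set" and y a :: "nat \<Rightarrow> 'a" and \<phi> :: "nat \<Rightarrow> 'a \<Rightarrow> 'a"
  assumes A: "is_subring A" and comm: "\<And>u v. u \<in> A \<Longrightarrow> v \<in> A \<Longrightarrow> u * v = v * u" and x: "x \<in> A"
  shows "finite S \<Longrightarrow> inj_on y S \<Longrightarrow> (\<And>i. i \<in> S \<Longrightarrow> y i \<in> A) \<Longrightarrow> (\<And>i. i \<in> S \<Longrightarrow> a i \<in> A) \<Longrightarrow>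
    (\<And>i z. i \<in> S \<Longrightarrow> z \<in> A \<Longrightarrow> \<phi> i (x * z) = y i * \<phi> i z) \<Longrightarrow> (\<And>i. i \<in> S \<Longrightarrow> \<phi> i 1 \<noteq> 0) \<Longrightarrow>
    (\<And>z. z \<in> A \<Longrightarrow> (\<Sum>i\<in>S. a i * \<phi> i z) = 0) \<Longrightarrow> i \<in> S \<Longrightarrow> a i = 0"
proof (induction S arbitrary: a i rule: finite_induct)
  case (insert k S)
  have zero: "a j * (y j - y k) = 0" if "j \<in> S" for j
  proof (rule insert.IH[of "\<lambda>j. a j * (y j - y k)" j])
    show "inj_on y S" using insert.prems(1) by simp
    show "y i \<in> A" "\<phi> i 1 \<noteq> 0" if "i \<in> S" for i using insert.prems(2,5) that by auto
    show "a i * (y i - y k) \<in> A" if "i \<in> S" for i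
      using insert.prems(2,3) that by (intro is_subringD(3,4)[OF A]) auto
    show "\<phi> i (x * z) = y i * \<phi> i z" if "i \<in> S" "z \<in> A" for i z using insert.prems(4) that by auto
    show "(\<Sum>j\<in>S. a j * (y j - y k) * \<phi> j z) = 0" if z: "z \<in> A" for z
    proof -
      have xz: "x * z \<in> A" using x z is_subringD(4)[OF A] by blast
      have "0 = (\<Sum>j\<in>insert k S. a j * \<phi> j (x * z)) - y k * (\<Sum>j\<in>insert k S. a j * \<phi> j z)"
        using insert.prems(6)[OF z] insert.prems(6)[OF xz] by simp
      also have "\<dots> = (\<Sum>j\<in>insert k S. a j * \<phi> j (x * z) - y k * (a j * \<phi> j z))"
        by (simp only: sum_distrib_left sum_subtractf)
      also have "\<dots> = (\<Sum>j\<in>insert k S. a j * (y j - y k) * \<phi> j z)"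
      proof (rule sum.cong[OF refl])
        fix j assume j: "j \<in> insert k S"
        have "y k * a j = a j * y k" using comm insert.prems(2)[of k] insert.prems(3)[OF j] by auto
        then have "y k * (a j * \<phi> j z) = a j * (y k * \<phi> j z)" by (metis mult.assoc)
        then show "a j * \<phi> j (x * z) - y k * (a j * \<phi> j z) = a j * (y j - y k) * \<phi> j z"
          using insert.prems(4)[OF j z] by (simp add: algebra_simps)
      qed
      also have "\<dots> = (\<Sum>j\<in>S. a j * (y j - y k) * \<phi> j z)" using insert.hyps by simp
      finally show ?thesis by simp
    qed
  qed (use that in auto)
  have S0: "a j = 0" if "j \<in> S" for j
  proof -
    have "y j \<noteq> y k" using insert.prems(1) insert.hyps(2) that by (auto simp: inj_on_def)
    then show ?thesis using zero[OF that] by simp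
  qed
  have "a k * \<phi> k 1 = 0" using insert.prems(6)[OF is_subringD(1)[OF A]] insert.hyps S0 by simp
  then have "a k = 0" using insert.prems(5)[of k] by simp
  then show ?case using S0 insert.prems(7) by auto
qed simp

text \<open>The norm-like map \<open>c \<mapsto> (c * b) ^ r\<close> from a finite field \<open>A\<close> to the subfield fixed by conjugation
  with \<open>b\<close> is surjective: by Hilbert 90 its fibres are no larger than those of a surjection.\<close>

lemma normalizing_torsion_commute:
  fixes x b :: "'a::division_ring"
  assumes char: "CHAR('a) > 0" and x: "torsion x" and b: "torsion b" and bx: "b * x = x ^ k * b"
  shows "b * x = x * b"
proof (rule ccontr)
  assume no: "b * x \<noteq> x * b"
  have x0: "x \<noteq> 0" and b0: "b \<noteq> 0" using x b torsion_nonzero by auto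
  \<comment> \<open>The order of conjugation by \<open>b\<close> as it acts on
    \<open>x\<close>.\<close>
  define r where "r = (LEAST r. r > 0 \<and> b ^ r * x = x * b ^ r)"
  obtain n where "n > 0" "b ^ n = 1" using b unfolding torsion_def by auto
  then have "\<exists>r. r > 0 \<and> b ^ r * x = x * b ^ r" by (intro exI[of _ n]) auto
  from LeastI_ex[OF this] have r: "r > 0" "b ^ r * x = x * b ^ r" unfolding r_def by auto
  have least: "b ^ j * x \<noteq> x * b ^ j" if "0 < j" "j < r" for j
    using not_less_Least[of j "\<lambda>r. r > 0 \<and> b ^ r * x = x * b ^ r"] that unfolding r_def by auto
  have r2: "1 < r" using r no by (cases "r = 1") auto
  \<comment> \<open>\<open>A\<close> will be a finite field stable under conjugation by
    \<open>b\<close>; \<open>b ^ r\<close> is included so that \<open>(c * b) ^ r\<close> lands in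
    \<open>A\<close>.\<close>
  have "\<exists>A. finite A \<and> is_subring A \<and> {x, b ^ r} \<subseteq> A \<and> (\<forall>B. is_subring B \<longrightarrow> {x, b ^ r} \<subseteq> B \<longrightarrow> A \<subseteq> B)"
    by (rule finite_subring_of_torsion[OF char]) (use x torsion_power[OF b] r in auto)
  then obtain A where A: "finite A" "is_subring A" "x \<in> A" "b ^ r \<in> A"
    and A_least: "\<And>B. is_subring B \<Longrightarrow> x \<in> B \<Longrightarrow> b ^ r \<in> B \<Longrightarrow> A \<subseteq> B" by auto
  have cent: "is_subring {u::'a. \<forall>v\<in>S. v * u = u * v}" for S
    by (intro division_subring_is_subring division_subring_centralizer)
  have "A \<subseteq> {u. \<forall>v\<in>{x, b ^ r}. v * u = u * v}" by (rule A_least[OF cent]) (use r in auto)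
  then have "A \<subseteq> {u. \<forall>v\<in>A. v * u = u * v}" by (intro A_least[OF cent]) auto
  then have comm: "u * v = v * u" if "u \<in> A" "v \<in> A" for u v using that by auto
  define \<sigma> where "\<sigma> i u = b ^ i * u * inverse (b ^ i)" for i u
  have \<sigma>_mult: "\<sigma> i (u * v) = \<sigma> i u * \<sigma> i v" for i u v
    unfolding \<sigma>_def using b0 by (simp add: mult.assoc flip: mult.assoc[of "inverse (b ^ i)"])
  have \<sigma>_b: "b ^ i * u = \<sigma> i u * b ^ i" for i u unfolding \<sigma>_def using b0 by (simp add: mult.assoc)
  have \<sigma>1: "\<sigma> 1 u \<in> A" if "u \<in> A" for u
  proof -
    have "is_subring {u. \<sigma> 1 u \<in> A}"
      unfolding is_subring_def
    proof (intro conjI ballI)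
      show "1 \<in> {u. \<sigma> 1 u \<in> A}" using is_subringD(1)[OF A(2)] b0 unfolding \<sigma>_def by simp
      fix u v assume uv: "u \<in> {u. \<sigma> 1 u \<in> A}" "v \<in> {u. \<sigma> 1 u \<in> A}"
      have "\<sigma> 1 (u - v) = \<sigma> 1 u - \<sigma> 1 v" unfolding \<sigma>_def by (simp add: algebra_simps)
      then show "u - v \<in> {u. \<sigma> 1 u \<in> A}" using uv is_subringD(3)[OF A(2)] by simp
      show "u * v \<in> {u. \<sigma> 1 u \<in> A}" using uv is_subringD(4)[OF A(2)] by (simp add: \<sigma>_mult)
    qed
    moreover have "\<sigma> 1 x = x ^ k" unfolding \<sigma>_def using bx b0 by (simp add: mult.assoc)
    then have "\<sigma> 1 x \<in> A" using is_subringD(7)[OF A(2,3)] by simp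
    moreover have "\<sigma> 1 (b ^ r) = b ^ r" unfolding \<sigma>_def using b0
      by (simp add: mult.assoc flip: power_commutes)
    then have "\<sigma> 1 (b ^ r) \<in> A" using A(4) by simp
    ultimately show ?thesis using A_least that by blast
  qed
  have \<sigma>_Suc: "\<sigma> (Suc i) u = \<sigma> 1 (\<sigma> i u)" for i u
  proof -
    have "inverse (b ^ Suc i) = inverse (b ^ i) * inverse b"
      using b0 by (simp add: nonzero_inverse_mult_distrib)
    then show ?thesis unfolding \<sigma>_def by (simp add: mult.assoc)
  qed
  have \<sigma>A: "\<sigma> i u \<in> A" if "u \<in> A" for i u
  proof (induction i)
    case 0
    then show ?case using that by (simp add: \<sigma>_def)
  next
    case (Suc i)
    then show ?case using \<sigma>1 \<sigma>_Suc by metis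
  qed
  have \<sigma>_0: "\<sigma> i u \<noteq> 0" if "u \<noteq> 0" for i u unfolding \<sigma>_def using that b0 by simp
  have \<sigma>_x: "inj_on (\<lambda>i. \<sigma> i x) {..<r}"
  proof -
    have ne: "\<sigma> i x \<noteq> \<sigma> j x" if "i < j" "j < r" for i j
    proof
      assume eq: "\<sigma> i x = \<sigma> j x"
      have "b ^ i * (b ^ (j - i) * x) = b ^ j * x" using that by (simp flip: mult.assoc power_add)
      also have "\<dots> = \<sigma> i x * b ^ j" unfolding eq by (rule \<sigma>_b)
      also have "\<dots> = \<sigma> i x * b ^ i * b ^ (j - i)" using that by (simp add: mult.assoc flip: power_add)
      also have "\<dots> = b ^ i * (x * b ^ (j - i))" unfolding \<sigma>_b[symmetric] by (simp add: mult.assoc)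
      finally have "b ^ (j - i) * x = x * b ^ (j - i)" using b0 by simp
      then show False using least[of "j - i"] that by auto
    qed
    show ?thesis
    proof (rule inj_onI)
      fix i j assume ij: "i \<in> {..<r}" "j \<in> {..<r}" "\<sigma> i x = \<sigma> j x"
      show "i = j" using ne[of i j] ne[of j i] ij by (cases i j rule: linorder_cases) auto
    qed
  qed
  define L where "L = A - {0}"
  define L0 where "L0 = {c\<in>L. b * c = c * b}"
  define M where "M c = (c * b) ^ r" for c
  have Linv: "inverse c \<in> L" if "c \<in> L" for c
    using that finite_subring_inverse[OF A(1,2)] unfolding L_def by auto
  have Lm: "c * d \<in> L" if "c \<in> L" "d \<in> L" for c d
    using that is_subringD(4)[OF A(2)] unfolding L_def by auto
  have cb: "\<exists>d\<in>L. (c * b) ^ i = d * b ^ i" if c: "c \<in> L" for c i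
  proof (induction i)
    case 0
    then show ?case using is_subringD(1)[OF A(2)] unfolding L_def by (intro bexI[of _ 1]) auto
  next
    case (Suc i)
    then obtain d where d: "d \<in> L" "(c * b) ^ i = d * b ^ i" by blast
    have "b * d = \<sigma> 1 d * b" using \<sigma>_b[of 1 d] by simp
    then have "(c * b) ^ Suc i = (c * \<sigma> 1 d) * b ^ Suc i"
      unfolding power_Suc d(2) by (metis mult.assoc)
    moreover have "\<sigma> 1 d \<in> L" using d(1) \<sigma>1[of d] \<sigma>_0[of d 1] unfolding L_def by auto
    then have "c * \<sigma> 1 d \<in> L" by (rule Lm[OF c])
    ultimately show ?case by blast
  qed
  \<comment> \<open>\<open>M c\<close> commutes with \<open>c * b\<close> as a power of it, and with
    \<open>c\<close> as an element of \<open>A\<close>, hence with \<open>b\<close>.\<close>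
  have M_L0: "M c \<in> L0" if c: "c \<in> L" for c
  proof -
    obtain d where d: "d \<in> L" "M c = d * b ^ r" using cb[OF c] unfolding M_def by blast
    have "b ^ r \<in> L" unfolding L_def using A(4) b0 by simp
    then have McL: "M c \<in> L" unfolding d(2) by (rule Lm[OF d(1)])
    have "c * b * M c = M c * (c * b)" unfolding M_def by (simp add: power_commutes)
    also have "\<dots> = c * (M c * b)" using comm[of c "M c"] c McL unfolding L_def by (metis DiffD1 mult.assoc)
    finally have "c * (b * M c) = c * (M c * b)" by (simp add: mult.assoc)
    then have "b * M c = M c * b" using c unfolding L_def by simp
    then show ?thesis unfolding L0_def using McL by simp
  qed
  have fin: "finite L" unfolding L_def using A(1) by simp
  have oneL: "1 \<in> L" unfolding L_def using is_subringD(1)[OF A(2)] by simp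
  have one0: "1 \<in> L0" unfolding L0_def using oneL by simp
  \<comment> \<open>A Lagrange resolvent: the sum of \<open>B ^ i * z * inverse (C ^ i)\<close> over
    \<open>i < r\<close> is invariant under \<open>w \<mapsto> B * w * inverse C\<close> because
    \<open>B ^ r = C ^ r\<close>, and semilinear independence makes it nonzero for some
    \<open>z\<close>.\<close>
  have hilbert90: "\<exists>w\<in>L. c = w * d * inverse (\<sigma> 1 w)" if c: "c \<in> L" and d: "d \<in> L" and eq: "M c = M d" for c d
  proof -
    define B where "B = c * b"
    define C where "C = d * b"
    have BC0: "B \<noteq> 0" "C \<noteq> 0" unfolding B_def C_def using c d b0 unfolding L_def by auto
    obtain c' where c': "\<And>i. c' i \<in> L" "\<And>i. B ^ i = c' i * b ^ i" using cb[OF c] unfolding B_def by metis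
    obtain d' where d': "\<And>i. d' i \<in> L" "\<And>i. C ^ i = d' i * b ^ i" using cb[OF d] unfolding C_def by metis
    define a where "a i = c' i * inverse (d' i)" for i
    have aL: "a i \<in> L" for i unfolding a_def using c' d' Lm Linv by blast
    have summand: "B ^ i * z * inverse (C ^ i) = a i * \<sigma> i z" if z: "z \<in> A" for i z
    proof -
      have "d' i \<noteq> 0" using d'(1) unfolding L_def by blast
      then have "B ^ i * z * inverse (C ^ i) = c' i * \<sigma> i z * inverse (d' i)"
        unfolding c'(2) d'(2) \<sigma>_def using b0 by (simp add: nonzero_inverse_mult_distrib mult.assoc)
      also have "\<dots> = a i * \<sigma> i z"
        using comm[OF \<sigma>A[OF z, of i], of "inverse (d' i)"] Linv[OF d'(1)]
        unfolding a_def L_def by (metis DiffD1 mult.assoc)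
      finally show ?thesis .
    qed
    define W where "W z = (\<Sum>i<r. a i * \<sigma> i z)" for z
    have WA: "W z \<in> A" if "z \<in> A" for z
      unfolding W_def
      by (rule subring_sum[OF A(2)], rule is_subringD(4)[OF A(2)]) (use aL \<sigma>A[OF that] in \<open>auto simp: L_def\<close>)
    have "\<exists>z\<in>A. W z \<noteq> 0"
    proof (rule ccontr)
      assume "\<not> ?thesis"
      then have W0: "W z = 0" if "z \<in> A" for z using that by auto
      have "a 0 = 0"
      proof (rule semilinear_independent[OF A(2) comm A(3), of "{..<r}" "\<lambda>i. \<sigma> i x" a \<sigma> 0])
        show "inj_on (\<lambda>i. \<sigma> i x) {..<r}" by (rule \<sigma>_x)
        show "(\<Sum>i<r. a i * \<sigma> i z) = 0" if "z \<in> A" for z using W0[OF that] unfolding W_def .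
      qed (use r(1) aL \<sigma>A[OF A(3)] \<sigma>_mult \<sigma>_0[of 1] in \<open>auto simp: L_def\<close>)
      then show False using aL unfolding L_def by blast
    qed
    then obtain z where z: "z \<in> A" "W z \<noteq> 0" by blast
    define w where "w = W z"
    have wL: "w \<in> L" unfolding w_def L_def using z WA by auto
    have w_eq: "w = (\<Sum>i<r. B ^ i * z * inverse (C ^ i))" unfolding w_def W_def using summand[OF z(1)] by simp
    have "B * w * inverse C = (\<Sum>i<r. B ^ Suc i * z * inverse (C ^ Suc i))"
      unfolding w_eq sum_distrib_left sum_distrib_right
      by (rule sum.cong) (use BC0 in \<open>simp_all add: nonzero_inverse_mult_distrib power_commutes mult.assoc flip: power_Suc2\<close>)
    also have "\<dots> = w"
    proof -
      have "B ^ r = C ^ r" using eq unfolding M_def B_def C_def .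
      moreover have "B ^ r \<in> A" using M_L0[OF c] unfolding M_def B_def L0_def L_def by auto
      then have "B ^ r * z = z * B ^ r" using comm z(1) by blast
      ultimately have "B ^ r * z * inverse (C ^ r) = z" using BC0 by (simp add: mult.assoc)
      moreover have "(\<Sum>i<r. B ^ Suc i * z * inverse (C ^ Suc i)) + z = w + B ^ r * z * inverse (C ^ r)"
        using sum.lessThan_Suc_shift[of "\<lambda>i. B ^ i * z * inverse (C ^ i)" r] unfolding w_eq
        by (simp add: add.commute)
      ultimately show ?thesis by simp
    qed
    finally have "B * w * inverse C * C = w * C" by simp
    then have "B * w = w * C" using BC0 by (simp add: mult.assoc)
    moreover have "B * w = c * \<sigma> 1 w * b" unfolding B_def using \<sigma>_b[of 1 w] by (simp add: mult.assoc)
    ultimately have "c * \<sigma> 1 w * b = w * d * b" unfolding C_def by (simp add: mult.assoc)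
    then have "c * \<sigma> 1 w = w * d" using b0 by simp
    then have "c = w * d * inverse (\<sigma> 1 w)"
      using \<sigma>_0[of w 1] wL unfolding L_def
      by (metis DiffD2 insertI1 mult.assoc mult.right_neutral right_inverse)
    then show ?thesis using wL by blast
  qed
  \<comment> \<open>A fibre of \<open>M\<close> lies in the image of \<open>\<rho>\<close>, and each
    fibre of \<open>\<rho>\<close> contains a coset \<open>w * L0\<close>.\<close>
  have card_fibre: "card L0 * card {c\<in>L. M c = m} \<le> card L" if m: "m \<in> M ` L" for m
  proof -
    obtain d where d: "d \<in> L" "M d = m" using m by blast
    define \<rho> where "\<rho> w = w * d * inverse (\<sigma> 1 w)" for w
    have "{c\<in>L. M c = m} \<subseteq> \<rho> ` L"
    proof
      fix c assume "c \<in> {c\<in>L. M c = m}"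
      then have "c \<in> L" "M c = M d" using d(2) by auto
      from hilbert90[OF this(1) d(1) this(2)] show "c \<in> \<rho> ` L" unfolding \<rho>_def by blast
    qed
    then have "card {c\<in>L. M c = m} \<le> card (\<rho> ` L)" using fin by (simp add: card_mono)
    moreover have "card L0 * card (\<rho> ` L) \<le> card L"
    proof (rule card_fibres_ge[OF fin])
      fix e assume "e \<in> \<rho> ` L"
      then obtain w where w: "w \<in> L" "e = \<rho> w" by blast
      have "(\<lambda>u. w * u) ` L0 \<subseteq> {a\<in>L. \<rho> a = e}"
      proof
        fix v assume "v \<in> (\<lambda>u. w * u) ` L0"
        then obtain u where u: "u \<in> L0" "v = w * u" by blast
        have uL: "u \<in> L" "u \<noteq> 0" using u(1) unfolding L0_def L_def by auto
        have "\<sigma> 1 u = u" using u(1) b0 unfolding \<sigma>_def L0_def by (simp add: mult.assoc)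
        then have "\<sigma> 1 v = \<sigma> 1 w * u" unfolding u(2) \<sigma>_mult by simp
        moreover have w0: "\<sigma> 1 w \<noteq> 0" using \<sigma>_0 w(1) unfolding L_def by blast
        ultimately have "\<rho> v = w * (u * d) * inverse u * inverse (\<sigma> 1 w)"
          unfolding \<rho>_def u(2) using uL(2) by (simp add: nonzero_inverse_mult_distrib mult.assoc)
        also have "u * d = d * u" using comm uL(1) d(1) unfolding L_def by blast
        finally have "\<rho> v = e" unfolding w(2) \<rho>_def using uL(2) by (simp add: mult.assoc flip: mult.assoc[of u])
        then show "v \<in> {a\<in>L. \<rho> a = e}" using Lm[OF w(1) uL(1)] u(2) by simp
      qed
      moreover have "card ((\<lambda>u. w * u) ` L0) = card L0"
        by (rule card_image) (use w(1) in \<open>auto simp: inj_on_def L_def\<close>)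
      ultimately show "card L0 \<le> card {a\<in>L. \<rho> a = e}" using fin
        by (metis (no_types, lifting) card_mono finite_subset mem_Collect_eq subsetI)
    qed
    ultimately show ?thesis by (meson le_trans mult_le_mono2)
  qed
  have L0pos: "card L0 > 0" using one0 fin unfolding L0_def by (auto simp: card_gt_0_iff)
  \<comment> \<open>Since the fibres of \<open>M\<close> have at most
    \<open>card L / card L0\<close> elements, \<open>M\<close> takes at least \<open>card L0\<close>
    values; all of them lie in \<open>L0\<close>, so 1 is among them.\<close>
  have "card L \<le> (card L div card L0) * card (M ` L)"
    by (rule card_fibres_le[OF fin]) (use card_fibre L0pos in \<open>auto simp: less_eq_div_iff_mult_less_eq mult.commute\<close>)
  then have "card L0 * card L \<le> card L0 * ((card L div card L0) * card (M ` L))" by simp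
  also have "\<dots> \<le> card L * card (M ` L)"
    by (metis mult.assoc mult_le_mono1 times_div_less_eq_dividend)
  finally have "card L0 \<le> card (M ` L)" using oneL fin
    by (metis card_gt_0_iff empty_iff mult.commute mult_le_cancel1)
  moreover have "M ` L \<subseteq> L0" using M_L0 by blast
  moreover have "finite L0" unfolding L0_def using fin by simp
  ultimately have "M ` L = L0" by (simp add: card_subset_eq card_mono le_antisym)
  then obtain c where c: "c \<in> L" "M c = 1" using one0 by (metis imageE)
  define B where "B = c * b"
  have Br: "B ^ r = 1" using c(2) unfolding M_def B_def .
  have B0: "B \<noteq> 0" unfolding B_def using c(1) b0 unfolding L_def by auto
  \<comment> \<open>As \<open>B ^ r = 1\<close> and \<open>B \<noteq> 1\<close>, the geometric sum
    vanishes. But \<open>B ^ i\<close> conjugates \<open>x\<close> to \<open>\<sigma> i x\<close>,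
    and these are distinct, so the powers of \<open>B\<close> are independent.\<close>
  have "(B - 1) * (\<Sum>i<m. B ^ i) = B ^ m - 1" for m
    by (induction m) (auto simp: algebra_simps)
  then have "(B - 1) * (\<Sum>i<r. B ^ i) = 0" using Br by simp
  then have "B = 1 \<or> (\<Sum>i<r. B ^ i) = 0" by simp
  moreover have "B \<noteq> 1"
  proof
    assume "B = 1"
    then have "c * b * x = x * (c * b)" unfolding B_def by simp
    also have "\<dots> = c * (x * b)" using comm[OF A(3), of c] c(1) unfolding L_def by (metis DiffD1 mult.assoc)
    finally have "c * (b * x) = c * (x * b)" by (simp add: mult.assoc)
    then show False using no c(1) unfolding L_def by simp
  qed
  moreover have "(\<Sum>i<r. B ^ i) \<noteq> 0"
  proof
    assume sum0: "(\<Sum>i<r. B ^ i) = 0"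
    have Bx: "B ^ i * (x * z) = \<sigma> i x * (B ^ i * z)" for i z
    proof -
      obtain d where d: "d \<in> L" "B ^ i = d * b ^ i" using cb[OF c(1)] unfolding B_def by blast
      have "d * \<sigma> i x = \<sigma> i x * d" using comm d(1) \<sigma>A[OF A(3)] unfolding L_def by blast
      then show ?thesis unfolding d(2) using \<sigma>_b[of i x] by (metis mult.assoc)
    qed
    have "(1::'a) = 0"
    proof (rule semilinear_independent[OF A(2) comm A(3), of "{..<r}" "\<lambda>i. \<sigma> i x" "\<lambda>_. 1" "\<lambda>i z. B ^ i * z" 0])
      show "(\<Sum>i<r. 1 * (B ^ i * z)) = 0" for z using sum0 by (simp flip: sum_distrib_right)
    qed (use r(1) \<sigma>_x \<sigma>A[OF A(3)] Bx is_subringD(1)[OF A(2)] B0 in auto)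
    then show False by simp
  qed
  ultimately show False by blast
qed

text \<open>Every nonzero element of \<open>E\<close> is torsion here, so a noncentral
  \<open>x\<close> would have a noncommuting normalizing element that is itself torsion, which
  \<open>normalizing_torsion_commute\<close> excludes.\<close>

lemma normal_radical_central_torsion:
  fixes E :: "'a::division_ring set"
  assumes E: "division_subring E" "fin_dim_over_center E" and N: "normal_in E N"
    and rad: "radical_over N (center_of E)" and char: "CHAR('a) > 0"
    and tors: "\<And>f. f \<in> center_of E \<Longrightarrow> f \<noteq> 0 \<Longrightarrow> torsion f"
  shows "N \<subseteq> center_of E"
proof (rule subsetI, rule ccontr)
  fix x assume x: "x \<in> N" "x \<notin> center_of E"
  have xE: "x \<in> E" "x \<noteq> 0" using x(1) N unfolding normal_in_def by auto
  have torsE: "torsion d" if "d \<in> E" "d \<noteq> 0" for d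
    by (rule torsion_if_center_torsion[OF E char tors that])
  obtain v k where v: "v \<in> E" "v \<noteq> 0" "v * x = x ^ k * v" "v * x \<noteq> x * v"
    by (rule torsion_normalizer[OF E(1) xE(1) x(2) torsE[OF xE] char])
  then show False
    using normalizing_torsion_commute[OF char torsE[OF xE] torsE[OF v(1,2)] v(3)] by blast
qed

lemma normal_radical_central:
  fixes E :: "'a::division_ring set"
  assumes "division_subring E" "fin_dim_over_center E" "normal_in E N" "radical_over N (center_of E)"
  shows "N \<subseteq> center_of E"
proof (cases "CHAR('a) = 0")
  case True
  then show ?thesis using normal_radical_central_char_0[OF assms] by blast
next
  case False
  then show ?thesis
    using normal_radical_central_char_p[OF assms] normal_radical_central_torsion[OF assms] by blast
qed

section \<open>Reduction to the centrally finite case\<close>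

text \<open>The Cartan-Brauer-Hua computation: \<open>u * a = a * z\<close> and
  \<open>v * (a + 1) = (a + 1) * z\<close> give \<open>(u - v) * a = v - z\<close>; as
  \<open>a\<close> is outside \<open>K\<close>, both sides vanish.\<close>

lemma conjugates_in_subring_commute:
  fixes K :: "'a::division_ring set"
  assumes K: "division_subring K" and a: "a \<notin> K"
    and z: "z \<in> K" "a * z * inverse a \<in> K" "(a + 1) * z * inverse (a + 1) \<in> K"
  shows "z * a = a * z"
proof -
  have a0: "a \<noteq> 0" using a division_subringD(2)[OF K] by auto
  have a1: "a + 1 \<noteq> 0"
  proof
    assume "a + 1 = 0"
    then have "a = - 1" by (simp add: eq_neg_iff_add_eq_0)
    then show False using a division_subringD(1,5)[OF K] by blast
  qed
  define u where "u = a * z * inverse a"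
  define v where "v = (a + 1) * z * inverse (a + 1)"
  have u: "u * a = a * z" unfolding u_def using a0 by (simp add: mult.assoc)
  have v: "v * (a + 1) = (a + 1) * z" unfolding v_def using a1 by (simp add: mult.assoc)
  have uv: "(u - v) * a = v - z" using u v by (simp add: algebra_simps)
  have "u = v"
  proof (rule ccontr)
    assume "u \<noteq> v"
    then have "a = inverse (u - v) * (v - z)" unfolding uv[symmetric] by (simp flip: mult.assoc)
    moreover have "u \<in> K" "v \<in> K" using z unfolding u_def v_def by auto
    ultimately have "a \<in> K" using z(1) K by (metis division_subringD(3,4,8))
    then show False using a by blast
  qed
  then have "v = z" using uv by simp
  then show ?thesis using u \<open>u = v\<close> by simp
qed

lemma radical_power_commutes:
  fixes K N :: "'a::division_ring set"
  assumes K: "division_subring K" "K \<noteq> UNIV" and N: "normal_subgroup_units N" and rad: "radical_over N K"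
    and y: "y \<in> N"
  obtains n where "n > 0" "y ^ n * a = a * y ^ n"
proof -
  have outside: "\<exists>n>0. y ^ n * a = a * y ^ n" if a: "a \<notin> K" for a
  proof -
    have a0: "a \<noteq> 0" "a + 1 \<noteq> 0"
      using a division_subringD(1,2,5)[OF K(1)] by (auto simp: eq_neg_iff_add_eq_0[symmetric])
    have conj: "\<exists>n>0. d * y ^ n * inverse d \<in> K" if "d \<noteq> 0" for d
    proof -
      have "d * y * inverse d \<in> N" using N y that unfolding normal_subgroup_units_def by blast
      then obtain n where "n > 0" "(d * y * inverse d) ^ n \<in> K" using rad unfolding radical_over_def by blast
      then show ?thesis using conj_power[OF that] by metis
    qed
    obtain n1 where n1: "n1 > 0" "y ^ n1 \<in> K" using rad y unfolding radical_over_def by blast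
    obtain n2 where n2: "n2 > 0" "a * y ^ n2 * inverse a \<in> K" using conj[OF a0(1)] by blast
    obtain n3 where n3: "n3 > 0" "(a + 1) * y ^ n3 * inverse (a + 1) \<in> K" using conj[OF a0(2)] by blast
    \<comment> \<open>A common multiple of the three exponents brings the power and both of its
      conjugates into \<open>K\<close> at once.\<close>
    define n where "n = n1 * n2 * n3"
    have "y ^ n = (y ^ n1) ^ (n2 * n3)" unfolding n_def by (simp add: mult.assoc flip: power_mult)
    then have k1: "y ^ n \<in> K" using division_subringD(7)[OF K(1) n1(2)] by simp
    have "a * y ^ n * inverse a = (a * y ^ n2 * inverse a) ^ (n1 * n3)"
      unfolding conj_power[OF a0(1)] n_def by (simp add: mult.commute mult.left_commute flip: power_mult)
    then have k2: "a * y ^ n * inverse a \<in> K" using division_subringD(7)[OF K(1) n2(2)] by simp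
    have "(a + 1) * y ^ n * inverse (a + 1) = ((a + 1) * y ^ n3 * inverse (a + 1)) ^ (n1 * n2)"
      unfolding conj_power[OF a0(2)] n_def by (simp add: mult.commute flip: power_mult)
    then have k3: "(a + 1) * y ^ n * inverse (a + 1) \<in> K" using division_subringD(7)[OF K(1) n3(2)] by simp
    show ?thesis
      using conjugates_in_subring_commute[OF K(1) a k1 k2 k3] n1(1) n2(1) n3(1)
      by (intro exI[of _ n]) (simp add: n_def)
  qed
  show thesis
  proof (cases "a \<in> K")
    case False
    then show thesis using outside that by blast
  next
    case True
    \<comment> \<open>An element \<open>a\<close> of \<open>K\<close> is the difference of
      \<open>a + b\<close> and \<open>b\<close>, both outside \<open>K\<close>; a common power
      commutes with each.\<close>
    obtain b where b: "b \<notin> K" using K(2) by blast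
    have ab: "a + b \<notin> K"
    proof
      assume "a + b \<in> K"
      then have "(a + b) - a \<in> K" using True division_subringD(3)[OF K(1)] by blast
      then show False using b by simp
    qed
    obtain n where n: "n > 0" "y ^ n * b = b * y ^ n" using outside[OF b] by blast
    obtain m where m: "m > 0" "y ^ m * (a + b) = (a + b) * y ^ m" using outside[OF ab] by blast
    have 1: "y ^ (n * m) * b = b * y ^ (n * m)"
      unfolding power_mult by (rule power_commuting_commutes[OF n(2)])
    have 2: "y ^ (n * m) * (a + b) = (a + b) * y ^ (n * m)"
      unfolding mult.commute[of n m] power_mult by (rule power_commuting_commutes[OF m(2)])
    have "y ^ (n * m) * a = a * y ^ (n * m)" using 1 2 by (simp add: distrib_left distrib_right)
    then show thesis using that[of "n * m"] n m by simp
  qed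
qed

lemma division_subring_gen: "division_subring (gen_division_subring S)"
  unfolding gen_division_subring_def division_subring_def by auto

theorem theorem6p6:
  fixes K N :: "'a::division_ring set"
  assumes "weakly_locally_finite TYPE('a)"
    and "division_subring K" and "K \<noteq> UNIV"
    and "normal_subgroup_units N" and "radical_over N K"
  shows "N \<subseteq> center_of (UNIV :: 'a set)"
proof
  fix x assume x: "x \<in> N"
  have "x * a = a * x" for a
  proof -
    \<comment> \<open>Whether \<open>x\<close> and \<open>a\<close> commute can be tested in the
      division subring they generate, which is finite dimensional over its center.\<close>
    define E where "E = gen_division_subring {x, a}"
    have E: "division_subring E" "fin_dim_over_center E"
      unfolding E_def using division_subring_gen assms(1) unfolding weakly_locally_finite_def by auto
    have xa: "x \<in> E" "a \<in> E" unfolding E_def gen_division_subring_def by auto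
    have "normal_in E (N \<inter> E)"
      using assms(4) division_subringD(4,8)[OF E(1)]
      unfolding normal_in_def normal_subgroup_units_def by auto
    moreover have "radical_over (N \<inter> E) (center_of E)"
      unfolding radical_over_def
    proof
      fix y assume y: "y \<in> N \<inter> E"
      obtain n where n: "n > 0" "y ^ n * x = x * y ^ n"
        by (rule radical_power_commutes[OF assms(2-5)]) (use y in auto)
      obtain m where m: "m > 0" "y ^ m * a = a * y ^ m"
        by (rule radical_power_commutes[OF assms(2-5)]) (use y in auto)
      have 1: "y ^ (n * m) * x = x * y ^ (n * m)"
        unfolding power_mult by (rule power_commuting_commutes[OF n(2)])
      have 2: "y ^ (n * m) * a = a * y ^ (n * m)"
        unfolding mult.commute[of n m] power_mult by (rule power_commuting_commutes[OF m(2)])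
      \<comment> \<open>The centralizer of this power is a division subring containing both
        generators of \<open>E\<close>.\<close>
      have "E \<subseteq> {u. \<forall>v\<in>{y ^ (n * m)}. v * u = u * v}"
        unfolding E_def gen_division_subring_def
        by (rule Inter_lower) (use 1 2 division_subring_centralizer[of "{y ^ (n * m)}"] in auto)
      then have "y ^ (n * m) \<in> center_of E"
        unfolding center_of_def using division_subringD(7)[OF E(1)] y by auto
      then show "\<exists>n>0. y ^ n \<in> center_of E" using n(1) m(1) by (intro exI[of _ "n * m"]) simp
    qed
    ultimately have "N \<inter> E \<subseteq> center_of E" by (rule normal_radical_central[OF E])
    then show ?thesis using x xa center_ofD(2) by blast
  qed
  then show "x \<in> center_of (UNIV :: 'a set)" unfolding center_of_def by auto
qed

end
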